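(* Let $\mathcal{N}=\mathcal{M}\otimes M_2$ be a $W^*$-algebra of type $I_2$, where $\mathcal{M}$ is a commutative $W^*$-algebra with unit $\mathbf{1}$, and let $H$ be a complex Hilbert space. Let $F_{ij}:\mathcal{M}\to H$ ($i,j=1,2$) be orthogonal vector fields (respectively, $w^*$-continuous orthogonal vector fields) with the following properties: (i) $\langle F_{11}(a),F_{22}(b)\rangle=\langle F_{12}(a),F_{21}(b)\rangle=0$ for all $a,b\in\mathcal{M}$; (ii) $\|F_{12}(a)\|^2+\|F_{21}(a)\|^2=\|F_{11}(a)\|^2+\|F_{22}(a)\|^2$ for all $a\in\mathcal{M}$; (iii) $\langle F_{ij}(a),F_{kl}(b)\rangle=\langle F_{ij}(b^*a),F_{kl}(\mathbf{1})\rangle$ for all $a,b\in\mathcal{M}$ and all $i,j,k,l\in\{1,2\}$; (iv) $\langle F_{12}(\pi),F_{11}(\mathbf{1})\rangle=\langle F_{22}(\mathbf{1}),F_{21}(\pi)\rangle$ and $\langle F_{21}(\pi),F_{11}(\mathbf{1})\rangle=\langle F_{22}(\mathbf{1}),F_{12}(\pi)\rangle$ for all $\pi\in\mathcal{M}^{\mathrm{pr}}$. Then the linear mapping $F:\mathcal{N}\to H$ defined by the equalities $F(a\varepsilon_{ij})=F_{ij}(a)$, $a\in\mathcal{M}$, $i,j=1,2$ (that is, $F((x_{ij}))=\sum_{i,j=1}^2F_{ij}(x_{ij})$), is an orthogonal vector field (respectively, a $w^*$-continuous orthogonal vector field).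
   Context: For a $W^*$-algebra $\mathcal{A}$, $\mathcal{A}^{\mathrm{pr}}$ denotes the set of orthogonal projections in $\mathcal{A}$. Inner products are linear in the first argument. A bounded linear map $F:\mathcal{A}\to H$ into a complex Hilbert space $H$ is an orthogonal vector field (OVF) if for all $p,q\in\mathcal{A}^{\mathrm{pr}}$, $pq=0$ implies $\langle F(p),F(q)\rangle=0$. A linear map $F:\mathcal{A}\to H$ with this orthogonality property that is continuous from the $w^*$-topology of $\mathcal{A}$ to the weak topology of $H$ is called a $w^*$-continuous OVF (such a map is automatically bounded). Every $W^*$-algebra of type $I_2$ has the form $\mathcal{N}=\mathcal{M}\otimes M_2$ with $\mathcal{M}$ a commutative $W^*$-algebra and $M_2$ the algebra of $2\times 2$ complex matrices; its elements are the $2\times2$ matrices $(x_{ij})$ with entries $x_{ij}\in\mathcal{M}$. For $a\in\mathcal{M}$, $a\varepsilon_{ij}\in\mathcal{N}$ denotes the matrix whose $(i,j)$ entry is $a$ and whose other entries are $0$. *)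

theory Defs
  imports "HOL-Analysis.Analysis"
begin

section \<open>Complex vector spaces and Hilbert spaces\<close>

class complex_vector = ab_group_add +
  fixes scaleC :: "complex \<Rightarrow> 'a \<Rightarrow> 'a"  (infixr "*\<^sub>C" 75)
  assumes scaleC_add_right: "a *\<^sub>C (x + y) = a *\<^sub>C x + a *\<^sub>C y"
    and scaleC_add_left: "(a + b) *\<^sub>C x = a *\<^sub>C x + b *\<^sub>C x"
    and scaleC_scaleC: "a *\<^sub>C (b *\<^sub>C x) = (a * b) *\<^sub>C x"
    and scaleC_one: "1 *\<^sub>C x = x"

instantiation complex :: complex_vector
begin
definition scaleC_complex :: "complex \<Rightarrow> complex \<Rightarrow> complex" where
  "scaleC_complex a x = a * x"
instance
  by standard (simp_all add: scaleC_complex_def algebra_simps)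
end

(* The inner product is linear in the first argument.  Positive definiteness follows from
   cinner_same together with the norm axioms inherited from banach. *)
class chilbert_space = complex_vector + banach +
  fixes cinner :: "'a \<Rightarrow> 'a \<Rightarrow> complex"
  assumes scaleR_scaleC: "r *\<^sub>R x = complex_of_real r *\<^sub>C x"
    and cinner_commute: "cinner x y = cnj (cinner y x)"
    and cinner_add_left: "cinner (x + y) z = cinner x z + cinner y z"
    and cinner_scaleC_left: "cinner (a *\<^sub>C x) y = a * cinner x y"
    and cinner_same: "cinner x x = complex_of_real ((norm x)\<^sup>2)"

abbreviation clinear :: "('a::complex_vector \<Rightarrow> 'b::complex_vector) \<Rightarrow> bool" where
  "clinear \<equiv> Vector_Spaces.linear (*\<^sub>C) (*\<^sub>C)"

lemma vector_space_scaleC: "vector_space ((*\<^sub>C) :: complex \<Rightarrow> 'a::complex_vector \<Rightarrow> 'a)"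
  by unfold_locales
    (simp_all add: scaleC_add_right scaleC_add_left scaleC_scaleC scaleC_one)

lemma clinear_iff:
  "clinear f \<longleftrightarrow> (\<forall>x y. f (x + y) = f x + f y) \<and> (\<forall>c x. f (c *\<^sub>C x) = c *\<^sub>C f x)"
  by (simp add: Vector_Spaces.linear_iff vector_space_scaleC)

text \<open>
  Norms on the domain are passed explicitly, because the C*-norm of the matrix algebra below
  is not the norm of the library type of matrices.
\<close>

definition bounded_clinear ::
  "('a::complex_vector \<Rightarrow> real) \<Rightarrow> ('a \<Rightarrow> 'b::{complex_vector, real_normed_vector}) \<Rightarrow> bool" where
  "bounded_clinear nrm f \<longleftrightarrow> clinear f \<and> (\<exists>C. \<forall>x. norm (f x) \<le> C * nrm x)"

definition dual :: "('a::complex_vector \<Rightarrow> real) \<Rightarrow> ('a \<Rightarrow> complex) set" where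
  "dual nrm = {f. bounded_clinear nrm f}"

definition dual_norm :: "('a \<Rightarrow> real) \<Rightarrow> ('a \<Rightarrow> complex) \<Rightarrow> real" where
  "dual_norm nrm f = (SUP x \<in> {x. nrm x \<le> 1}. cmod (f x))"

(* the coarsest topology making all members of P continuous *)
definition weak_topology :: "('a \<Rightarrow> complex) set \<Rightarrow> 'a topology" where
  "weak_topology P = topology_generated_by {f -` U | f U. f \<in> P \<and> open U}"


section \<open>C*-algebras and W*-algebras\<close>

class complex_star_algebra_1 = complex_vector + ring_1 +
  fixes adj :: "'a \<Rightarrow> 'a"
  assumes mult_scaleC_left: "(a *\<^sub>C x) * y = a *\<^sub>C (x * y)"
    and mult_scaleC_right: "x * (a *\<^sub>C y) = a *\<^sub>C (x * y)"
    and adj_adj: "adj (adj x) = x"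
    and adj_add: "adj (x + y) = adj x + adj y"
    and adj_scaleC: "adj (a *\<^sub>C x) = cnj a *\<^sub>C adj x"
    and adj_mult: "adj (x * y) = adj y * adj x"

locale cstar_algebra =
  fixes nrm :: "'a::complex_star_algebra_1 \<Rightarrow> real"
  assumes nrm_eq_0: "nrm x = 0 \<longleftrightarrow> x = 0"
    and nrm_triangle: "nrm (x + y) \<le> nrm x + nrm y"
    and nrm_scaleC: "nrm (a *\<^sub>C x) = cmod a * nrm x"
    and nrm_mult: "nrm (x * y) \<le> nrm x * nrm y"
    and nrm_cstar: "nrm (adj x * x) = (nrm x)\<^sup>2"
    and complete: "Metric_space.mcomplete UNIV (\<lambda>x y. nrm (x - y))"

text \<open>
  A W*-algebra is a C*-algebra that is isometrically the dual of a Banach space.  The predual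
  is realised as a norm-closed subspace \<open>P\<close> of the dual; the last two axioms say
  that the evaluation map from the algebra to the dual of \<open>P\<close> is isometric and onto.
  The w*-topology is then \<open>weak_topology P\<close>.
\<close>
locale wstar_algebra = cstar_algebra nrm
  for nrm :: "'a::complex_star_algebra_1 \<Rightarrow> real" +
  fixes P :: "('a \<Rightarrow> complex) set"
  assumes predual_subset: "P \<subseteq> dual nrm"
    and predual_zero: "(\<lambda>x. 0) \<in> P"
    and predual_add: "\<lbrakk>f \<in> P; g \<in> P\<rbrakk> \<Longrightarrow> (\<lambda>x. f x + g x) \<in> P"
    and predual_scale: "f \<in> P \<Longrightarrow> (\<lambda>x. c * f x) \<in> P"
    and predual_closed:
      "\<lbrakk>f \<in> dual nrm; \<And>e. e > 0 \<Longrightarrow> \<exists>g\<in>P. dual_norm nrm (\<lambda>x. f x - g x) \<le> e\<rbrakk> \<Longrightarrow> f \<in> P"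
    and predual_isometric: "nrm x = (SUP f \<in> {f \<in> P. dual_norm nrm f \<le> 1}. cmod (f x))"
    and predual_onto:
      "\<lbrakk>\<And>f g. \<lbrakk>f \<in> P; g \<in> P\<rbrakk> \<Longrightarrow> L (\<lambda>x. f x + g x) = L f + L g;
        \<And>c f. f \<in> P \<Longrightarrow> L (\<lambda>x. c * f x) = c * L f;
        \<And>f. f \<in> P \<Longrightarrow> cmod (L f) \<le> C * dual_norm nrm f\<rbrakk>
       \<Longrightarrow> \<exists>x. \<forall>f\<in>P. L f = f x"

definition projections :: "'a::complex_star_algebra_1 set" where
  "projections = {p. adj p = p \<and> p * p = p}"


section \<open>Orthogonal vector fields\<close>

definition orthogonal_on_projections ::
  "('a::complex_star_algebra_1 \<Rightarrow> 'h::chilbert_space) \<Rightarrow> bool" where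
  "orthogonal_on_projections F \<longleftrightarrow>
     (\<forall>p\<in>projections. \<forall>q\<in>projections. p * q = 0 \<longrightarrow> cinner (F p) (F q) = 0)"

definition ovf ::
  "('a::complex_star_algebra_1 \<Rightarrow> real) \<Rightarrow> ('a \<Rightarrow> 'h::chilbert_space) \<Rightarrow> bool" where
  "ovf nrm F \<longleftrightarrow> bounded_clinear nrm F \<and> orthogonal_on_projections F"

(* P is the predual of the domain *)
definition wstar_continuous_ovf ::
  "('a::complex_star_algebra_1 \<Rightarrow> complex) set \<Rightarrow> ('a \<Rightarrow> 'h::chilbert_space) \<Rightarrow> bool" where
  "wstar_continuous_ovf P F \<longleftrightarrow>
     clinear F \<and> orthogonal_on_projections F \<and>
     continuous_map (weak_topology P) (weak_topology (dual norm)) F"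


section \<open>Two by two matrices\<close>

(* A separate type is needed because the multiplication of the library type 'a^2^2 as a
   class instance is the entrywise one.  The indices are the elements 1 and 2 of the type 2. *)
datatype 'a mat2 = Mat2 (entries: "'a^2^2")

instantiation mat2 :: (complex_star_algebra_1) complex_star_algebra_1
begin
definition "0 = Mat2 0"
definition "1 = Mat2 (mat 1)"
definition "x + y = Mat2 (entries x + entries y)"
definition "x - y = Mat2 (entries x - entries y)"
definition "- x = Mat2 (- entries x)"
definition "x * y = Mat2 (entries x ** entries y)"
definition "c *\<^sub>C x = Mat2 (\<chi> i j. c *\<^sub>C (entries x $ i $ j))"
definition "adj x = Mat2 (\<chi> i j. adj (entries x $ j $ i))"
instance
proof
  fix x y z :: "'a mat2" and a b :: complex
  have adj_sum: "adj (\<Sum>k\<in>UNIV. f k) = (\<Sum>k\<in>UNIV. adj (f k))" for f :: "2 \<Rightarrow> 'a"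
    by (simp add: sum_2 adj_add)
  have scaleC_sum: "c *\<^sub>C (\<Sum>k\<in>UNIV. f k) = (\<Sum>k\<in>UNIV. c *\<^sub>C f k)"
    for c and f :: "2 \<Rightarrow> 'a"
    by (simp add: sum_2 scaleC_add_right)
  note defs = zero_mat2_def one_mat2_def plus_mat2_def minus_mat2_def uminus_mat2_def
    times_mat2_def scaleC_mat2_def adj_mat2_def
  show "x + y + z = x + (y + z)" "x + y = y + x" "0 + x = x" "- x + x = 0" "x - y = x + - y"
    by (simp_all add: defs algebra_simps)
  show "x * y * z = x * (y * z)" "1 * x = x" "x * 1 = x"
    by (simp_all add: defs matrix_mul_assoc)
  show "(x + y) * z = x * z + y * z" "x * (y + z) = x * y + x * z"
    by (simp_all add: defs vec_eq_iff matrix_matrix_mult_def sum_2 algebra_simps)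
  show "(0 :: 'a mat2) \<noteq> 1"
    by (auto simp: defs vec_eq_iff mat_def)
  show "a *\<^sub>C (x + y) = a *\<^sub>C x + a *\<^sub>C y" "(a + b) *\<^sub>C x = a *\<^sub>C x + b *\<^sub>C x"
    "a *\<^sub>C (b *\<^sub>C x) = (a * b) *\<^sub>C x" "1 *\<^sub>C x = x"
    by (simp_all add: defs vec_eq_iff scaleC_add_right scaleC_add_left scaleC_scaleC
        scaleC_one mat2.expand)
  show "(a *\<^sub>C x) * y = a *\<^sub>C (x * y)" "x * (a *\<^sub>C y) = a *\<^sub>C (x * y)"
    by (simp_all add: defs vec_eq_iff matrix_matrix_mult_def scaleC_sum mult_scaleC_left
        mult_scaleC_right)
  show "adj (adj x) = x" "adj (x + y) = adj x + adj y" "adj (a *\<^sub>C x) = cnj a *\<^sub>C adj x"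
    by (simp_all add: defs vec_eq_iff adj_adj adj_add adj_scaleC mat2.expand)
  show "adj (x * y) = adj y * adj x"
    by (simp add: defs vec_eq_iff matrix_matrix_mult_def adj_sum adj_mult)
qed
end

definition matrix_unit :: "2 \<Rightarrow> 2 \<Rightarrow> 'a::zero \<Rightarrow> 'a mat2" where
  "matrix_unit i j a = Mat2 (\<chi> k l. if k = i \<and> l = j then a else 0)"

definition entrywise_map ::
  "(2 \<Rightarrow> 2 \<Rightarrow> 'a \<Rightarrow> 'b::comm_monoid_add) \<Rightarrow> 'a mat2 \<Rightarrow> 'b" where
  "entrywise_map F x = (\<Sum>i\<in>UNIV. \<Sum>j\<in>UNIV. F i j (entries x $ i $ j))"

lemma entrywise_map_matrix_unit:
  assumes "\<And>i j. F i j 0 = 0"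
  shows "entrywise_map F (matrix_unit i j a) = F i j a"
proof -
  have "F k l (if k = i \<and> l = j then a else 0) = (if l = j then if k = i then F i j a else 0 else 0)"
    for k l
    using assms by auto
  then show ?thesis
    by (simp add: entrywise_map_def matrix_unit_def)
qed

(* The predual of the W*-tensor product with the algebra of 2 x 2 complex matrices is the
   algebraic tensor product of the preduals. *)
definition mat2_predual :: "('a \<Rightarrow> complex) set \<Rightarrow> ('a mat2 \<Rightarrow> complex) set" where
  "mat2_predual P = {entrywise_map f | f. \<forall>i j. f i j \<in> P}"

end

theory Submission
  imports Defs
begin

text \<open>
  By (iii) every inner product \<open>\<langle>F\<^sub>i\<^sub>j(a), F\<^sub>k\<^sub>l(b)\<rangle>\<close> is the value at \<open>b\<^sup>*a\<close> of the linear functional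
  \<open>\<phi>\<^sub>i\<^sub>j\<^sub>k\<^sub>l = \<langle>F\<^sub>i\<^sub>j(\<cdot>), F\<^sub>k\<^sub>l(1)\<rangle>\<close> on the commutative algebra.  By (i), (ii) and \<open>pq = qp = 0\<close> the
  sixteen terms of \<open>\<langle>F(p), F(q)\<rangle>\<close> then cancel, provided that the identities (iv) between these
  functionals, assumed on projections only, hold everywhere.

  So a bounded functional vanishing on projections has to vanish.  A selfadjoint \<open>h\<close> has a sign
  projection \<open>g\<close>, and \<open>h - (\<parallel>h\<parallel>/2)(2g - 1)\<close> has at most half the norm of \<open>h\<close>; iterating exhausts \<open>h\<close> by
  projections.  The sign projection is the infimum of the powers of an element \<open>0 \<le> d \<le> 1\<close>, and
  the infimum of a decreasing sequence is a w*-cluster point of it.  Gelfand theory is avoided: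
  an element \<open>x\<close> counts as positive if it is selfadjoint and \<open>\<parallel>r - x\<parallel> \<le> r\<close> for some \<open>r\<close>.

  Boundedness of \<open>F\<close> requires \<open>\<parallel>x\<^sub>i\<^sub>j\<parallel> \<le> \<parallel>x\<parallel>\<close>, which holds because, by the sign projections again,
  the norm of the commutative algebra is the smallest C*-norm on it.
\<close>

section \<open>Scalars in a unital complex star-algebra\<close>

lemma scaleC_zero_left [simp]: "0 *\<^sub>C (x::'a::complex_vector) = 0"
  using scaleC_add_left[of 0 0 x] by simp

lemma scaleC_zero_right [simp]: "c *\<^sub>C (0::'a::complex_vector) = 0"
  using scaleC_add_right[of c 0 "0::'a"] by simp

lemma scaleC_minus_left: "(- c) *\<^sub>C (x::'a::complex_vector) = - (c *\<^sub>C x)"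
  using scaleC_add_left[of "- c" c x] by (simp add: eq_neg_iff_add_eq_0)

text \<open>Multiples \<open>c *\<^sub>C x\<close> are turned into products with the ring element
  \<open>of_scalar c\<close>, so that the ring simplification rules handle scalars as well.\<close>

definition of_scalar :: "complex \<Rightarrow> 'a::complex_star_algebra_1" where
  "of_scalar c = c *\<^sub>C 1"

definition of_r :: "real \<Rightarrow> 'a::complex_star_algebra_1" where
  "of_r r = of_scalar (complex_of_real r)"

lemma scaleC_conv_mult: "c *\<^sub>C x = of_scalar c * (x::'a::complex_star_algebra_1)"
  by (simp add: of_scalar_def mult_scaleC_left)

lemma of_scalar_0 [simp]: "of_scalar 0 = 0"
  and of_scalar_1 [simp]: "of_scalar 1 = 1"
  and of_scalar_add: "of_scalar (a + b) = of_scalar a + of_scalar b"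
  and of_scalar_mult: "of_scalar (a * b) = of_scalar a * of_scalar b"
  and of_scalar_minus: "of_scalar (- a) = - of_scalar a"
  by (simp_all add: of_scalar_def scaleC_one scaleC_add_left scaleC_minus_left
      mult_scaleC_left scaleC_scaleC)

lemma of_scalar_diff: "of_scalar (a - b) = of_scalar a - of_scalar b"
  using of_scalar_add[of a "- b"] by (simp add: of_scalar_minus)

lemma adj_one [simp]: "adj (1::'a::complex_star_algebra_1) = 1"
  by (metis adj_adj adj_mult mult.left_neutral)

lemma adj_zero [simp]: "adj (0::'a::complex_star_algebra_1) = 0"
  using adj_add[of "0::'a" 0] by simp

lemma adj_minus: "adj (- x) = - adj (x::'a::complex_star_algebra_1)"
  using adj_add[of x "- x"] by (simp add: eq_neg_iff_add_eq_0 add.commute)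

lemma adj_diff: "adj (x - y) = adj x - adj (y::'a::complex_star_algebra_1)"
  using adj_add[of x "- y"] by (simp add: adj_minus)

lemma adj_of_scalar: "adj (of_scalar c) = (of_scalar (cnj c) :: 'a::complex_star_algebra_1)"
  by (simp add: of_scalar_def adj_scaleC)

lemma adj_of_r [simp]: "adj (of_r r) = (of_r r :: 'a::complex_star_algebra_1)"
  by (simp add: of_r_def adj_of_scalar)

lemma of_r_0 [simp]: "of_r 0 = 0"
  and of_r_1 [simp]: "of_r 1 = 1"
  by (simp_all add: of_r_def)

lemma of_r_add: "of_r (a + b) = of_r a + of_r b"
  and of_r_mult: "of_r (a * b) = of_r a * of_r b"
  and of_r_diff: "of_r (a - b) = of_r a - of_r b"
  and of_r_minus: "of_r (- a) = - of_r a"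
  by (simp_all add: of_r_def of_scalar_add of_scalar_mult of_scalar_minus of_scalar_diff)

lemma of_r_half_double: "x = of_r (1/2) * (x + (x::'a::complex_star_algebra_1))"
proof -
  have "of_r (1/2) * (x + x) = (of_r (1/2) + of_r (1/2)) * x"
    by (simp only: distrib_left distrib_right)
  also have "\<dots> = x"
    by (simp flip: of_r_add)
  finally show ?thesis by simp
qed

section \<open>Selfadjoint elements and the Cartesian decomposition\<close>

definition selfadjoint :: "'a::complex_star_algebra_1 \<Rightarrow> bool" where
  "selfadjoint x \<longleftrightarrow> adj x = x"

lemma selfadjoint_simps [simp]:
  "selfadjoint (0::'a::complex_star_algebra_1)" "selfadjoint (1::'a)" "selfadjoint (of_r r :: 'a)"
  by (simp_all add: selfadjoint_def)

lemma selfadjoint_add [simp]: "selfadjoint x \<Longrightarrow> selfadjoint y \<Longrightarrow> selfadjoint (x + y)"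
  and selfadjoint_diff [simp]: "selfadjoint x \<Longrightarrow> selfadjoint y \<Longrightarrow> selfadjoint (x - y)"
  and selfadjoint_minus [simp]: "selfadjoint x \<Longrightarrow> selfadjoint (- x)"
  by (simp_all add: selfadjoint_def adj_add adj_diff adj_minus)

lemma selfadjoint_mult [simp]:
  fixes x y :: "'a::{comm_ring_1, complex_star_algebra_1}"
  shows "selfadjoint x \<Longrightarrow> selfadjoint y \<Longrightarrow> selfadjoint (x * y)"
  by (simp add: selfadjoint_def adj_mult mult.commute)

abbreviation imag_unit :: "'a::complex_star_algebra_1" where
  "imag_unit \<equiv> of_scalar \<i>"

lemma imag_unit_square: "imag_unit * imag_unit = (- 1 :: 'a::complex_star_algebra_1)"
  by (simp add: of_scalar_minus flip: of_scalar_mult)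

lemma cartesian_decomposition:
  fixes x :: "'a::{comm_ring_1, complex_star_algebra_1}"
  obtains a b where "selfadjoint a" "selfadjoint b" "x = a + imag_unit * b"
proof
  let ?a = "of_r (1/2) * (x + adj x)" and ?b = "of_r (1/2) * (imag_unit * (adj x - x))"
  show "selfadjoint ?a"
    by (simp add: selfadjoint_def adj_mult adj_add adj_adj algebra_simps)
  show "selfadjoint ?b"
    by (simp add: selfadjoint_def adj_mult adj_diff adj_adj adj_of_scalar of_scalar_minus algebra_simps)
  have "?a + imag_unit * ?b = of_r (1/2) * (x + adj x + imag_unit * imag_unit * (adj x - x))"
    by (simp only: algebra_simps)
  also have "\<dots> = of_r (1/2) * (x + x)"
    by (simp add: imag_unit_square)
  finally show "x = ?a + imag_unit * ?b"
    using of_r_half_double[of x] by simp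
qed


section \<open>C*-norms\<close>

text \<open>The norm axioms of \<open>cstar_algebra\<close> apart from completeness, so that the
  norm which a matrix norm induces on its upper left corner is an instance
  (\<open>cstar_norm_corner\<close>).\<close>

locale cstar_norm =
  fixes nrm :: "'a::complex_star_algebra_1 \<Rightarrow> real"
  assumes nrm_eq_0: "nrm x = 0 \<longleftrightarrow> x = 0"
    and nrm_triangle: "nrm (x + y) \<le> nrm x + nrm y"
    and nrm_scaleC: "nrm (a *\<^sub>C x) = cmod a * nrm x"
    and nrm_mult: "nrm (x * y) \<le> nrm x * nrm y"
    and nrm_cstar: "nrm (adj x * x) = (nrm x)\<^sup>2"
begin

lemma nrm_zero [simp]: "nrm 0 = 0"
  by (simp add: nrm_eq_0)

lemma nrm_minus [simp]: "nrm (- x) = nrm x"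
  using nrm_scaleC[of "-1" x] by (simp add: scaleC_minus_left scaleC_one)

lemma nrm_minus_commute: "nrm (x - y) = nrm (y - x)"
  using nrm_minus[of "x - y"] by simp

lemma nrm_nonneg [simp]: "0 \<le> nrm x"
  using nrm_triangle[of x "- x"] by simp

lemma nrm_of_scalar_mult: "nrm (of_scalar c * x) = cmod c * nrm x"
  by (simp add: nrm_scaleC flip: scaleC_conv_mult)

lemma nrm_of_r_mult: "nrm (of_r r * x) = \<bar>r\<bar> * nrm x"
  by (simp add: of_r_def nrm_of_scalar_mult)

lemma nrm_adj [simp]: "nrm (adj x) = nrm x"
proof -
  have le: "nrm y \<le> nrm (adj y)" for y
    using nrm_cstar[of y] nrm_mult[of "adj y" y]
    by (cases "nrm y = 0") (auto simp: power2_eq_square mult_le_cancel_right less_le)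
  show ?thesis
    using le[of x] le[of "adj x"] by (simp add: adj_adj)
qed

lemma nrm_one [simp]: "nrm 1 = 1"
  using nrm_cstar[of 1] nrm_eq_0[of 1] by (simp add: power2_eq_square)

lemma nrm_of_r [simp]: "nrm (of_r r) = \<bar>r\<bar>"
  using nrm_of_r_mult[of r 1] by simp

lemma nrm_diff_le: "nrm (x - y) \<le> nrm x + nrm y"
  using nrm_triangle[of x "- y"] by simp

lemma nrm_triangle_sub: "nrm x \<le> nrm y + nrm (x - y)"
  using nrm_triangle[of y "x - y"] by simp

lemma nrm_square: "selfadjoint x \<Longrightarrow> nrm (x * x) = (nrm x)\<^sup>2"
  using nrm_cstar[of x] by (simp add: selfadjoint_def)

end

locale comm_cstar_norm = cstar_norm nrm
  for nrm :: "'a::{comm_ring_1, complex_star_algebra_1} \<Rightarrow> real"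
begin

text \<open>The C*-identity for u = x + i y: as x and y commute, the mixed terms of adj u * u
  cancel.\<close>

lemma nrm_cartesian:
  assumes "selfadjoint x" "selfadjoint y"
  shows "(nrm (x + imag_unit * y))\<^sup>2 = nrm (x * x + y * y)"
proof -
  have "adj (x + imag_unit * y) * (x + imag_unit * y) = x * x - imag_unit * imag_unit * (y * y)"
    using assms by (simp add: selfadjoint_def adj_add adj_mult adj_of_scalar of_scalar_minus algebra_simps)
  also have "\<dots> = x * x + y * y"
    by (simp add: imag_unit_square)
  finally show ?thesis
    by (simp flip: nrm_cstar)
qed

text \<open>x is the real part of x + i y, and taking real parts does not increase the norm because
  \<open>adj\<close> is isometric. This stands in for monotonicity of the norm on positive elements
  whenever the larger one is a sum of two squares.\<close>

lemma nrm_square_le_sum_squares: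
  assumes "selfadjoint x" "selfadjoint y"
  shows "(nrm x)\<^sup>2 \<le> nrm (x * x + y * y)"
proof -
  define u where "u = x + imag_unit * y"
  have "x = of_r (1/2) * (u + adj u)"
    using assms of_r_half_double[of x]
    by (simp add: u_def selfadjoint_def adj_add adj_mult adj_of_scalar of_scalar_minus algebra_simps)
  then have "nrm x = 1/2 * nrm (u + adj u)"
    by (metis abs_of_pos nrm_of_r_mult zero_less_divide_1_iff zero_less_numeral)
  also have "\<dots> \<le> nrm u"
    using nrm_triangle[of u "adj u"] by simp
  finally have "(nrm x)\<^sup>2 \<le> (nrm u)\<^sup>2"
    by (simp add: power_mono)
  then show ?thesis
    using nrm_cartesian[OF assms] by (simp add: u_def)
qed

end

sublocale cstar_algebra \<subseteq> cstar_norm nrm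
  by (unfold_locales) (fact nrm_eq_0 nrm_triangle nrm_scaleC nrm_mult nrm_cstar)+

locale comm_cstar_algebra = cstar_algebra nrm
  for nrm :: "'a::{comm_ring_1, complex_star_algebra_1} \<Rightarrow> real"

sublocale comm_cstar_algebra \<subseteq> comm_cstar_norm nrm
  by unfold_locales

locale comm_wstar_algebra = wstar_algebra nrm P
  for nrm :: "'a::{comm_ring_1, complex_star_algebra_1} \<Rightarrow> real" and P

sublocale comm_wstar_algebra \<subseteq> comm_cstar_algebra nrm
  by unfold_locales

section \<open>Norm limits and completeness\<close>

lemma le_limit:
  fixes a :: real
  shows "(\<And>n. a \<le> X n) \<Longrightarrow> X \<longlonglongrightarrow> l \<Longrightarrow> a \<le> l"
  by (rule LIMSEQ_le_const) auto

context cstar_algebra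
begin

lemma nrm_Cauchy_convergent:
  assumes "\<And>e. e > 0 \<Longrightarrow> \<exists>N. \<forall>m\<ge>N. \<forall>n\<ge>N. nrm (x m - x n) < e"
  shows "\<exists>l. (\<lambda>n. nrm (x n - l)) \<longlonglongrightarrow> 0"
proof -
  interpret Metric_space UNIV "\<lambda>x y. nrm (x - y)"
  proof
    fix x y z
    show "nrm (x - y) = nrm (y - x)" by (fact nrm_minus_commute)
    show "nrm (x - z) \<le> nrm (x - y) + nrm (y - z)"
      using nrm_triangle[of "x - y" "y - z"] by simp
  qed (simp_all add: nrm_eq_0)
  have "MCauchy x"
    using assms by (auto simp: MCauchy_def)
  then obtain l where "limitin mtopology x l sequentially"
    using complete by (auto simp: mcomplete_def)
  then show ?thesis
    by (auto simp: limitin_metric_dist_null)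
qed

lemma nrm_geometric_convergent:
  assumes c: "0 \<le> c" "c < 1" and x: "\<And>n. nrm (x (Suc n) - x n) \<le> C * c ^ n"
  shows "\<exists>l. (\<lambda>n. nrm (x n - l)) \<longlonglongrightarrow> 0"
proof (rule nrm_Cauchy_convergent)
  fix e :: real assume "e > 0"
  have "0 \<le> C"
    using order_trans[OF nrm_nonneg x[of 0]] by simp
  \<comment> \<open>The bound is the closed form of the geometric sum C (c^n + ... +
    c^(n+j-1)).\<close>
  have *: "nrm (x (n + j) - x n) \<le> C * c ^ n * (1 - c ^ j) / (1 - c)" for n j
  proof (induction j)
    case (Suc j)
    have "nrm (x (n + Suc j) - x n) \<le> nrm (x (Suc (n + j)) - x (n + j)) + nrm (x (n + j) - x n)"
      using nrm_triangle[of "x (Suc (n + j)) - x (n + j)" "x (n + j) - x n"] by simp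
    also have "\<dots> \<le> C * c ^ (n + j) + C * c ^ n * (1 - c ^ j) / (1 - c)"
      using Suc.IH x[of "n + j"] by linarith
    also have "\<dots> = C * c ^ n * (1 - c ^ Suc j) / (1 - c)"
      using c by (simp add: field_simps power_add)
    finally show ?case .
  qed simp
  have "C * c ^ n * (1 - c ^ j) / (1 - c) \<le> C / (1 - c) * c ^ n" for n j
  proof -
    have "0 \<le> C * c ^ n / (1 - c)" and "1 - c ^ j \<le> 1"
      using c \<open>0 \<le> C\<close> by simp_all
    then have "C * c ^ n / (1 - c) * (1 - c ^ j) \<le> C * c ^ n / (1 - c) * 1"
      by (rule mult_left_mono[rotated])
    then show ?thesis by (simp only: times_divide_eq_left mult_1_right)
  qed
  then have **: "nrm (x (n + j) - x n) \<le> C / (1 - c) * c ^ n" for n j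
    by (rule order_trans[OF *])
  have "(\<lambda>n. C / (1 - c) * c ^ n) \<longlonglongrightarrow> 0"
    using c by (intro tendsto_mult_right_zero LIMSEQ_power_zero) auto
  from order_tendstoD(2)[OF this \<open>e > 0\<close>]
  obtain N where N: "C / (1 - c) * c ^ n < e" if "n \<ge> N" for n
    unfolding eventually_sequentially by blast
  have less: "nrm (x m - x n) < e" if "n \<ge> N" "m \<ge> n" for m n
    using **[of n "m - n"] N[of n] that by simp
  show "\<exists>N. \<forall>m\<ge>N. \<forall>n\<ge>N. nrm (x m - x n) < e"
  proof (intro exI allI impI)
    fix m n assume "N \<le> m" "N \<le> n"
    then show "nrm (x m - x n) < e"
      using less[of n m] less[of m n] nrm_minus_commute[of "x m" "x n"] by (cases "n \<le> m") auto
  qed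
qed

lemma selfadjoint_limit:
  assumes "\<And>n. selfadjoint (x n)" "(\<lambda>n. nrm (x n - l)) \<longlonglongrightarrow> 0"
  shows "selfadjoint l"
proof -
  have "nrm (adj l - l) \<le> nrm (x n - l) + nrm (x n - l)" for n
  proof -
    have "adj l - l = (x n - l) - adj (x n - l)"
      using assms(1)[of n] by (simp add: selfadjoint_def adj_diff)
    then show ?thesis
      using nrm_diff_le[of "x n - l" "adj (x n - l)"] by (simp only: nrm_adj)
  qed
  moreover have "(\<lambda>n. nrm (x n - l) + nrm (x n - l)) \<longlonglongrightarrow> 0"
    using tendsto_add[OF assms(2) assms(2)] by simp
  ultimately have "nrm (adj l - l) \<le> 0"
    by (rule le_limit)
  then have "nrm (adj l - l) = 0"
    using nrm_nonneg[of "adj l - l"] by linarith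
  then show ?thesis
    by (simp add: nrm_eq_0 selfadjoint_def)
qed

lemma nrm_limit_le:
  assumes "\<And>n. nrm (x n) \<le> r" "(\<lambda>n. nrm (x n - l)) \<longlonglongrightarrow> 0"
  shows "nrm l \<le> r"
proof -
  have "nrm l \<le> r + nrm (x n - l)" for n
    using assms(1)[of n] nrm_triangle_sub[of l "x n"] nrm_minus_commute[of l "x n"] by linarith
  moreover have "(\<lambda>n. r + nrm (x n - l)) \<longlonglongrightarrow> r"
    using tendsto_add[OF tendsto_const assms(2)] by simp
  ultimately show ?thesis
    by (rule le_limit)
qed

end

section \<open>Square roots near the unit by fixed-point iteration\<close>

context comm_cstar_algebra
begin

text \<open>With \<open>k = 1 - x\<close> the equation reads \<open>x = (b + x\<^sup>2) / 2\<close>; its right hand side is a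
  contraction of the ball of radius \<open>1 - sqrt (1 - nrm b)\<close>.\<close>
lemma sqrt_one_minus:
  assumes b: "selfadjoint b" "nrm b < 1"
  obtains k where "selfadjoint k" "k * k = 1 - b" "nrm (1 - k) \<le> 1"
proof -
  \<comment> \<open>\<open>r\<close> is the smaller root of (nrm b + r^2) / 2 = r. So
    \<open>T\<close> maps the ball of radius \<open>r\<close> into itself, and \<open>r\<close> < 1
    is its contraction constant there.\<close>
  define r where "r = 1 - sqrt (1 - nrm b)"
  have r: "0 \<le> r" "r < 1" and rr: "(nrm b + r * r) / 2 = r"
    using b(2) by (simp_all add: r_def field_simps)
  define T where "T x = of_r (1/2) * (b + x * x)" for x
  define x where "x n = (T ^^ n) 0" for n
  have x0: "x 0 = 0" and xS: "x (Suc n) = T (x n)" for n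
    by (simp_all add: x_def)
  have Tr: "nrm (T y) \<le> r" if "nrm y \<le> r" for y
  proof -
    have "nrm (T y) \<le> (nrm b + nrm y * nrm y) / 2"
      using nrm_triangle[of b "y * y"] nrm_mult[of y y] by (simp add: T_def nrm_of_r_mult)
    also have "\<dots> \<le> (nrm b + r * r) / 2"
      using that r by (simp add: mult_mono)
    finally show ?thesis by (simp add: rr)
  qed
  have Tc: "nrm (T y - T z) \<le> r * nrm (y - z)" if "nrm y \<le> r" "nrm z \<le> r" for y z
  proof -
    have "T y - T z = of_r (1/2) * ((y - z) * (y + z))"
      by (simp add: T_def algebra_simps)
    then have "nrm (T y - T z) = 1/2 * nrm ((y - z) * (y + z))"
      by (simp add: nrm_of_r_mult)
    moreover have "nrm ((y - z) * (y + z)) \<le> nrm (y - z) * nrm (y + z)"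
      by (rule nrm_mult)
    moreover have "nrm (y + z) \<le> r + r"
      using nrm_triangle[of y z] that by linarith
    then have "nrm (y - z) * nrm (y + z) \<le> nrm (y - z) * (r + r)"
      by (rule mult_left_mono) simp
    moreover have "nrm (y - z) * (r + r) = 2 * (r * nrm (y - z))"
      by (simp add: algebra_simps)
    ultimately show ?thesis
      by linarith
  qed
  have xr: "nrm (x n) \<le> r" for n
    by (induction n) (simp_all add: x0 xS r Tr)
  have xsa: "selfadjoint (x n)" for n
    by (induction n) (simp_all add: x0 xS T_def b)
  have "nrm (x (Suc n) - x n) \<le> nrm (x 1 - x 0) * r ^ n" for n
  proof (induction n)
    case (Suc n)
    have "nrm (x (Suc (Suc n)) - x (Suc n)) \<le> r * nrm (x (Suc n) - x n)"
      using Tc[OF xr[of "Suc n"] xr[of n]] by (simp add: xS)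
    also have "\<dots> \<le> r * (nrm (x 1 - x 0) * r ^ n)"
      using Suc r by (simp add: mult_left_mono)
    finally show ?case by (simp add: algebra_simps)
  qed simp
  then obtain l where l: "(\<lambda>n. nrm (x n - l)) \<longlonglongrightarrow> 0"
    using nrm_geometric_convergent[of r x] r by blast
  have lsa: "selfadjoint l" and lr: "nrm l \<le> r"
    using selfadjoint_limit[OF xsa l] nrm_limit_le[OF xr l] by auto
  have "nrm (T l - l) \<le> r * nrm (x n - l) + nrm (x (Suc n) - l)" for n
    using nrm_triangle[of "T l - T (x n)" "x (Suc n) - l"] Tc[OF lr xr[of n]]
      nrm_minus_commute[of l "x n"] by (simp add: xS)
  moreover have "(\<lambda>n. r * nrm (x n - l) + nrm (x (Suc n) - l)) \<longlonglongrightarrow> r * 0 + 0"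
    using l by (intro tendsto_intros LIMSEQ_Suc)
  ultimately have "nrm (T l - l) \<le> r * 0 + 0"
    by (rule le_limit)
  then have "T l = l"
    using nrm_nonneg[of "T l - l"] nrm_eq_0[of "T l - l"] by simp
  then have "l + l = of_r (1/2) * (b + l * l) + of_r (1/2) * (b + l * l)"
    by (simp only: T_def)
  also have "\<dots> = b + l * l"
    by (simp only: flip: distrib_left of_r_half_double)
  finally have "l + l = b + l * l" .
  then have "(1 - l) * (1 - l) = 1 - b"
    by (simp add: algebra_simps)
  then show ?thesis
    using that[of "1 - l"] lsa lr r by simp
qed

end

section \<open>The order of a commutative C*-algebra\<close>

context comm_cstar_algebra
begin

text \<open>For a real-valued function the bound says 0 \<le> x \<le> 2 r pointwise. Being a
  statement about norms, it passes to norm limits and w*-limits once the radius is kept under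
  control.\<close>

definition pos :: "'a \<Rightarrow> bool" where
  "pos x \<longleftrightarrow> selfadjoint x \<and> (\<exists>r\<ge>0. nrm (of_r r - x) \<le> r)"

lemma pos_selfadjoint: "pos x \<Longrightarrow> selfadjoint x"
  by (simp add: pos_def)

lemma posI: "nrm (of_r r - x) \<le> r \<Longrightarrow> selfadjoint x \<Longrightarrow> 0 \<le> r \<Longrightarrow> pos x"
  by (auto simp: pos_def)

lemma pos_of_r: "0 \<le> r \<Longrightarrow> pos (of_r r)"
  by (rule posI[of r]) simp_all

lemma pos_zero [simp]: "pos 0"
  using pos_of_r[of 0] by simp

lemma pos_one [simp]: "pos 1"
  using pos_of_r[of 1] by simp

lemma pos_add:
  assumes "pos x" "pos y"
  shows "pos (x + y)"
proof -
  obtain r s where r: "r \<ge> 0" "nrm (of_r r - x) \<le> r" and s: "s \<ge> 0" "nrm (of_r s - y) \<le> s"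
    using assms by (auto simp: pos_def)
  have eq: "of_r (r + s) - (x + y) = (of_r r - x) + (of_r s - y)"
    by (simp add: of_r_add)
  have "nrm (of_r (r + s) - (x + y)) \<le> r + s"
    unfolding eq using nrm_triangle[of "of_r r - x" "of_r s - y"] r s by linarith
  then show ?thesis
    by (rule posI) (simp_all add: assms pos_selfadjoint r s)
qed

lemma pos_scale:
  assumes "0 \<le> c" "pos x"
  shows "pos (of_r c * x)"
proof -
  obtain r where r: "r \<ge> 0" "nrm (of_r r - x) \<le> r"
    using assms by (auto simp: pos_def)
  have "of_r (c * r) - of_r c * x = of_r c * (of_r r - x)"
    by (simp add: of_r_mult algebra_simps)
  then have "nrm (of_r (c * r) - of_r c * x) \<le> c * r"
    using r assms by (simp add: nrm_of_r_mult mult_left_mono)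
  then show ?thesis
    by (rule posI) (simp_all add: assms pos_selfadjoint r)
qed

lemma nrm_le_imp_pos_diff:
  assumes "selfadjoint x" "nrm x \<le> r"
  shows "pos (of_r r - x)" "pos (of_r r + x)"
proof -
  have "0 \<le> r"
    using assms(2) nrm_nonneg order_trans by blast
  then show "pos (of_r r - x)" "pos (of_r r + x)"
    using assms by (auto intro!: posI[of r])
qed

text \<open>With \<open>k\<^sup>2 + y\<^sup>2 = 1\<close> the element \<open>k + i y\<close> is unitary, whence \<open>nrm k \<le> 1\<close>.\<close>
lemma nrm_one_minus_square_le:
  assumes y: "selfadjoint y" "nrm y < 1"
  shows "nrm (1 - y * y) \<le> 1"
proof -
  have "nrm (y * y) < 1"
    using y by (simp add: nrm_square power_less_one_iff)
  then obtain k where k: "selfadjoint k" "k * k = 1 - y * y"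
    using sqrt_one_minus[of "y * y"] y by auto
  have "(nrm k)\<^sup>2 \<le> nrm (k * k + y * y)"
    using k y by (intro nrm_square_le_sum_squares)
  then show ?thesis
    using k by (simp flip: nrm_square)
qed

text \<open>\<open>nrm_one_minus_square_le\<close> for y / sqrt r, multiplied through by r.\<close>

lemma nrm_scaled_minus_square_le:
  assumes y: "selfadjoint y" "(nrm y)\<^sup>2 < r"
  shows "nrm (of_r r - y * y) \<le> r"
proof -
  have "0 < r"
    using y(2) by (smt (verit) zero_le_power2)
  define s where "s = 1 / sqrt r"
  have s: "s * s = 1 / r" "0 < s"
    using \<open>0 < r\<close> by (simp_all add: s_def)
  have "(nrm (of_r s * y))\<^sup>2 = (s * s) * (nrm y)\<^sup>2"
    using s(2) unfolding nrm_of_r_mult power_mult_distrib by (simp add: power2_eq_square)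
  then have "(nrm (of_r s * y))\<^sup>2 < 1"
    using y \<open>0 < r\<close> s by simp
  then have "nrm (of_r s * y) < 1"
    by (simp add: power_less_one_iff)
  then have *: "nrm (1 - (of_r s * y) * (of_r s * y)) \<le> 1"
    using y by (intro nrm_one_minus_square_le) simp_all
  have "(of_r s * y) * (of_r s * y) = of_r (s * s) * (y * y)"
    unfolding of_r_mult by (simp only: ac_simps)
  then have "of_r r * (1 - (of_r s * y) * (of_r s * y)) = of_r r - of_r (r * (s * s)) * (y * y)"
    unfolding of_r_mult by (simp add: right_diff_distrib mult.assoc)
  also have "\<dots> = of_r r - y * y"
    using \<open>0 < r\<close> by (simp add: s)
  finally have "nrm (of_r r - y * y) = r * nrm (1 - (of_r s * y) * (of_r s * y))"
    using \<open>0 < r\<close> by (simp flip: nrm_of_r_mult[of r, unfolded abs_of_pos[OF \<open>0 < r\<close>]])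
  then show ?thesis
    using * \<open>0 < r\<close> by simp
qed

lemma pos_square:
  assumes "selfadjoint y"
  shows "pos (y * y)"
proof -
  have "nrm (of_r ((nrm y)\<^sup>2 + 1) - y * y) \<le> (nrm y)\<^sup>2 + 1"
    using assms by (intro nrm_scaled_minus_square_le) auto
  then show ?thesis
    by (rule posI) (simp_all add: assms)
qed

text \<open>If nrm (r - x) \<le> r, then x + e = (r + e) (1 - b) with b = (r - x) / (r + e). The
  summand e makes nrm b < 1 strict, so \<open>sqrt_one_minus\<close> gives a root of 1 - b.\<close>

lemma pos_add_eps_square_root:
  assumes x: "pos x" and e: "0 < e"
  obtains k where "pos k" "k * k = x + of_r e"
proof -
  obtain r where r: "r \<ge> 0" "nrm (of_r r - x) \<le> r"
    using assms by (auto simp: pos_def)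
  define s where "s = 1 / (r + e)"
  have s: "0 < s" "s * (r + e) = 1"
    using r e by (simp_all add: s_def)
  define b where "b = of_r s * (of_r r - x)"
  have "nrm b \<le> s * r"
    using r s by (simp add: b_def nrm_of_r_mult)
  also have "\<dots> < 1"
    using r e by (simp add: s_def)
  finally have "nrm b < 1" .
  moreover have "selfadjoint b"
    using x by (simp add: b_def pos_selfadjoint)
  ultimately obtain k where k: "selfadjoint k" "k * k = 1 - b" "nrm (1 - k) \<le> 1"
    using sqrt_one_minus by blast
  have "pos k"
    using k by (intro posI[of 1]) simp_all
  define c where "c = sqrt (r + e)"
  have c: "0 < c" "c * c = r + e"
    using r e by (simp_all add: c_def)
  have "(of_r c * k) * (of_r c * k) = of_r (c * c) * (k * k)"
    unfolding of_r_mult by (simp only: ac_simps)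
  also have "\<dots> = of_r (r + e) - of_r (s * (r + e)) * (of_r r - x)"
    unfolding k b_def c of_r_mult by (simp add: algebra_simps)
  also have "\<dots> = x + of_r e"
    by (simp add: s of_r_add)
  finally show ?thesis
    using that pos_scale[of c k] c \<open>pos k\<close> by simp
qed

text \<open>Replaces the existential radius of \<open>pos\<close> by any bound of the norm, which
  makes radii uniform along sequences. Up to e / 3 the element is a square k * k with (nrm k)^2 < r
  + 2 e / 3, and \<open>nrm_scaled_minus_square_le\<close> applies to it.\<close>

lemma pos_nrm_diff_le:
  assumes "pos x" "nrm x \<le> r"
  shows "nrm (of_r r - x) \<le> r"
proof (rule field_le_epsilon)
  fix e :: real assume "e > 0"
  then obtain k where k: "pos k" "k * k = x + of_r (e / 3)"
    using pos_add_eps_square_root[OF assms(1), of "e / 3"] by auto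
  have "(nrm k)\<^sup>2 \<le> nrm x + e / 3"
    using k nrm_triangle[of x "of_r (e / 3)"] \<open>e > 0\<close> by (simp add: pos_selfadjoint flip: nrm_square)
  then have *: "nrm (of_r (r + 2 * e / 3) - k * k) \<le> r + 2 * e / 3"
    using assms k \<open>e > 0\<close> by (intro nrm_scaled_minus_square_le) (auto simp: pos_selfadjoint)
  have "r + 2 * e / 3 = r + e / 3 + e / 3"
    by simp
  then have "of_r (r + 2 * e / 3) - k * k = (of_r r - x) + of_r (e / 3)"
    by (simp only: of_r_add k) simp
  then show "nrm (of_r r - x) \<le> r + e"
    using * nrm_diff_le[of "(of_r r - x) + of_r (e / 3)" "of_r (e / 3)"] \<open>e > 0\<close> by simp
qed

text \<open>By \<open>pos_nrm_diff_le\<close> an approximant within e / 3 of x has radius nrm x + e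
  / 3; as e tends to 0 the defining bound holds for x with radius nrm x.\<close>

lemma pos_closed:
  assumes "selfadjoint x" "\<And>e. e > 0 \<Longrightarrow> \<exists>y. pos y \<and> nrm (y - x) \<le> e"
  shows "pos x"
proof -
  have "nrm (of_r (nrm x) - x) \<le> nrm x"
  proof (rule field_le_epsilon)
    fix e :: real assume "e > 0"
    then obtain y where y: "pos y" "nrm (y - x) \<le> e / 3"
      using assms(2)[of "e / 3"] by auto
    have "nrm (of_r (nrm x + e / 3) - y) \<le> nrm x + e / 3"
      using y nrm_triangle_sub[of y x] by (intro pos_nrm_diff_le) auto
    moreover have eq: "of_r (nrm x) - x = (of_r (nrm x + e / 3) - y) + ((y - x) - of_r (e / 3))"
      by (simp add: of_r_add)
    moreover have "nrm (of_r (e / 3)) = e / 3"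
      using \<open>e > 0\<close> by simp
    ultimately show "nrm (of_r (nrm x) - x) \<le> nrm x + e"
      using y nrm_triangle[of "of_r (nrm x + e / 3) - y" "(y - x) - of_r (e / 3)"]
        nrm_diff_le[of "y - x" "of_r (e / 3)"] \<open>e > 0\<close> unfolding eq by linarith
  qed
  then show ?thesis
    by (rule posI) (simp_all add: assms)
qed

lemma pos_eps:
  assumes "selfadjoint x" "\<And>e. e > 0 \<Longrightarrow> pos (x + of_r e)"
  shows "pos x"
proof (rule pos_closed)
  fix e :: real assume "e > 0"
  then show "\<exists>y. pos y \<and> nrm (y - x) \<le> e"
    using assms(2)[of e] by (intro exI[of _ "x + of_r e"]) simp
qed fact

lemma pos_limit:
  assumes "\<And>n. pos (x n)" "(\<lambda>n. nrm (x n - l)) \<longlonglongrightarrow> 0"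
  shows "pos l"
proof (rule pos_closed)
  show "selfadjoint l"
    using assms selfadjoint_limit pos_selfadjoint by blast
  fix e :: real assume "e > 0"
  then have "\<forall>\<^sub>F n in sequentially. nrm (x n - l) < e"
    using assms(2) by (simp add: order_tendstoD(2))
  then show "\<exists>y. pos y \<and> nrm (y - l) \<le> e"
    using assms(1) by (auto simp: eventually_sequentially intro: less_imp_le)
qed

text \<open>With k^2 = x + d and l^2 = y + d the product x y is approximated by the squares (k l)^2,
  since by commutativity they equal (x + d) (y + d).\<close>

lemma pos_mult:
  assumes "pos x" "pos y"
  shows "pos (x * y)"
proof (rule pos_closed)
  show "selfadjoint (x * y)"
    using assms by (simp add: pos_selfadjoint)
  fix e :: real assume "e > 0"
  \<comment> \<open>The error is d times the norm of x + y + d; d \<le> 1 bounds that norm by nrm x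
    + nrm y + 1, and the quotient then makes the error at most e.\<close>
  define d where "d = min 1 (e / (nrm x + nrm y + 1))"
  have S: "nrm x + nrm y + 1 > 0"
    using nrm_nonneg[of x] nrm_nonneg[of y] by linarith
  have d: "0 < d" "d \<le> 1" "d * (nrm x + nrm y + 1) \<le> e"
  proof -
    have "d \<le> e / (nrm x + nrm y + 1)"
      by (simp add: d_def)
    then show "d * (nrm x + nrm y + 1) \<le> e"
      using S by (simp only: pos_le_divide_eq)
  qed (use S \<open>e > 0\<close> in \<open>simp_all add: d_def\<close>)
  obtain k where k: "pos k" "k * k = x + of_r d"
    using pos_add_eps_square_root[OF assms(1) d(1)] .
  obtain l where l: "pos l" "l * l = y + of_r d"
    using pos_add_eps_square_root[OF assms(2) d(1)] .
  have "(k * l) * (k * l) = (x + of_r d) * (y + of_r d)"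
    by (simp only: ac_simps flip: k l)
  then have "(k * l) * (k * l) - x * y = of_r d * (x + y + of_r d)"
    by (simp add: algebra_simps)
  then have "nrm ((k * l) * (k * l) - x * y) = d * nrm (x + y + of_r d)"
    using d by (simp add: nrm_of_r_mult)
  also have "\<dots> \<le> d * (nrm x + nrm y + 1)"
    using nrm_triangle[of "x + y" "of_r d"] nrm_triangle[of x y] d by (simp add: mult_left_mono)
  also have "\<dots> \<le> e"
    by (fact d)
  finally show "\<exists>z. pos z \<and> nrm (z - x * y) \<le> e"
    using pos_square[of "k * l"] k l by (auto simp: pos_selfadjoint)
qed

text \<open>Up to e, both x and r - x are squares, and the sum of these squares is a scalar, so
  \<open>nrm_square_le_sum_squares\<close> bounds the norm of the first.\<close>

lemma pos_nrm_le:
  assumes "pos x" "pos (of_r r - x)" "0 \<le> r"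
  shows "nrm x \<le> r"
proof (rule field_le_epsilon)
  fix e :: real assume "e > 0"
  then have e: "e / 3 > 0" by simp
  obtain k where k: "pos k" "k * k = x + of_r (e / 3)"
    using pos_add_eps_square_root[OF assms(1) e] .
  obtain l where l: "pos l" "l * l = of_r r - x + of_r (e / 3)"
    using pos_add_eps_square_root[OF assms(2) e] .
  have "(nrm k)\<^sup>2 \<le> nrm (k * k + l * l)"
    using k l by (intro nrm_square_le_sum_squares pos_selfadjoint)
  also have "k * k + l * l = of_r (r + e / 3 + e / 3)"
    unfolding k l of_r_add by simp
  also have "nrm \<dots> = r + e / 3 + e / 3"
    using e assms(3) unfolding nrm_of_r by linarith
  finally have "nrm (x + of_r (e / 3)) \<le> r + e / 3 + e / 3"
    using k by (simp add: pos_selfadjoint flip: nrm_square)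
  then show "nrm x \<le> r + e"
    using nrm_diff_le[of "x + of_r (e / 3)" "of_r (e / 3)"] e by simp
qed

lemma pos_antisym: "pos x \<Longrightarrow> pos (- x) \<Longrightarrow> x = 0"
  using pos_nrm_le[of x 0] nrm_nonneg[of x] by (simp add: nrm_eq_0)

text \<open>The product of r - x and r + x is r^2 - x^2, so x^2 lies between 0 and r^2 and the
  C*-identity gives the norm of x.\<close>

lemma nrm_le_iff_pos:
  assumes "selfadjoint x" "0 \<le> r" "pos (of_r r - x)" "pos (of_r r + x)"
  shows "nrm x \<le> r"
proof -
  have "pos (of_r (r * r) - x * x)"
    using pos_mult[OF assms(3,4)] by (simp add: of_r_mult algebra_simps)
  then have "nrm (x * x) \<le> r * r"
    using assms pos_square[of x] by (intro pos_nrm_le) auto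
  then have "(nrm x)\<^sup>2 \<le> r\<^sup>2"
    unfolding nrm_square[OF assms(1)] by (simp add: power2_eq_square)
  then show ?thesis
    using assms(2) by (rule power2_le_imp_le)
qed

lemma square_eq_0: "selfadjoint x \<Longrightarrow> x * x = 0 \<Longrightarrow> x = (0::'a)"
  using nrm_square[of x] by (simp add: nrm_eq_0)

text \<open>The root is the norm limit of roots of x + (1/4)^n. Consecutive roots differ by at most
  (1/2)^n in norm, which is why the perturbations are powers of 1/4.\<close>

lemma pos_square_root:
  assumes x: "pos x"
  obtains k where "pos k" "k * k = x"
proof -
  have "\<exists>k. pos k \<and> k * k = x + of_r ((1/4) ^ n)" for n
  proof -
    have "(0::real) < (1/4) ^ n"
      by simp
    from pos_add_eps_square_root[OF x this] show ?thesis
      by blast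
  qed
  then obtain k where k: "\<And>n. pos (k n)" "\<And>n. k n * k n = x + of_r ((1/4) ^ n)"
    by metis
  have "nrm (k (Suc n) - k n) \<le> 1 * (1/2) ^ n" for n
  proof -
    \<comment> \<open>From w (s + t) = c, the element c w = w^2 (s + t) is positive, hence so is w.
      Then c - w^2 = w (s + t) - w (s - t) = 2 w t is positive, which bounds the norm of w^2 by
      c.\<close>
    define s t w where "s = k n" and "t = k (Suc n)" and "w = s - t"
    define c :: real where "c = (1/4) ^ n - (1/4) ^ Suc n"
    have c: "0 < c" "c \<le> (1/4) ^ n"
      by (simp_all add: c_def)
    have w: "w * (s + t) = of_r c"
      using k(2)[of n] k(2)[of "Suc n"]
      by (simp add: w_def s_def t_def c_def of_r_diff algebra_simps del: power_Suc)
    have "selfadjoint w"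
      using k(1) by (simp add: w_def s_def t_def pos_selfadjoint)
    have "pos (w * w * (s + t))"
      using k(1) \<open>selfadjoint w\<close> by (intro pos_mult pos_square pos_add) (simp_all add: s_def t_def)
    also have "w * w * (s + t) = of_r c * w"
      by (simp add: mult.assoc w)
    finally have "pos (of_r (1 / c) * (of_r c * w))"
      by (rule pos_scale[rotated]) (use c in simp)
    also have "of_r (1 / c) * (of_r c * w) = w"
      using c by (simp flip: mult.assoc of_r_mult)
    finally have "pos w" .
    have eq: "of_r c - w * w = w * t + w * t"
      unfolding w[symmetric] by (simp add: w_def algebra_simps)
    have "pos (of_r c - w * w)"
      unfolding eq t_def by (intro pos_add pos_mult \<open>pos w\<close> k(1))
    with \<open>selfadjoint w\<close> have "nrm (w * w) \<le> c"
      using \<open>selfadjoint w\<close> c by (intro pos_nrm_le pos_square) auto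
    then have "(nrm w)\<^sup>2 \<le> ((1/2) ^ n)\<^sup>2"
      using c \<open>selfadjoint w\<close> by (simp add: nrm_square power2_eq_square flip: power_mult_distrib)
    then have "nrm w \<le> (1/2) ^ n"
      by (rule power2_le_imp_le) simp
    then show ?thesis
      unfolding w_def s_def t_def nrm_minus_commute[of "k n"] by simp
  qed
  then obtain l where l: "(\<lambda>n. nrm (k n - l)) \<longlonglongrightarrow> 0"
    using nrm_geometric_convergent[of "1/2" k 1] by auto
  have "nrm (l * l - x) \<le> nrm (k n - l) * (2 * nrm l + nrm (k n - l)) + (1/4) ^ n" for n
  proof -
    have "l * l - x = of_r ((1/4) ^ n) - (k n - l) * (k n + l)"
      using k(2)[of n] by (simp add: algebra_simps)
    then have "nrm (l * l - x) \<le> (1/4) ^ n + nrm (k n - l) * nrm (k n + l)"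
      using nrm_diff_le[of "of_r ((1/4) ^ n)" "(k n - l) * (k n + l)"] nrm_mult[of "k n - l" "k n + l"]
      by simp
    moreover have "nrm (k n + l) \<le> 2 * nrm l + nrm (k n - l)"
      using nrm_triangle[of "k n" l] nrm_triangle_sub[of "k n" l] by linarith
    ultimately show ?thesis
      using mult_left_mono[of "nrm (k n + l)" "2 * nrm l + nrm (k n - l)" "nrm (k n - l)"] by simp
  qed
  moreover have "(\<lambda>n. nrm (k n - l) * (2 * nrm l + nrm (k n - l)) + (1/4) ^ n) \<longlonglongrightarrow> 0 * (2 * nrm l + 0) + 0"
    by (intro tendsto_intros l LIMSEQ_power_zero) simp
  ultimately have "nrm (l * l - x) \<le> 0 * (2 * nrm l + 0) + 0"
    by (rule le_limit)
  then have "l * l = x"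
    using nrm_nonneg[of "l * l - x"] nrm_eq_0[of "l * l - x"] by simp
  then show ?thesis
    using that pos_limit[OF k(1) l] by blast
qed

end

section \<open>Weak topologies\<close>

lemma topspace_weak_topology: "P \<noteq> {} \<Longrightarrow> topspace (weak_topology P) = UNIV"
  unfolding weak_topology_def topology_generated_by_topspace
  by (auto intro!: exI[of _ UNIV])

lemma continuous_map_weak_topology_functional:
  assumes "f \<in> P"
  shows "continuous_map (weak_topology P) euclidean f"
proof -
  have "topspace (weak_topology P) = UNIV"
    using assms by (intro topspace_weak_topology) auto
  moreover have "openin (weak_topology P) (f -` U)" if "open U" for U
    unfolding weak_topology_def using assms that by (intro topology_generated_by_Basis) blast
  ultimately show ?thesis
    by (simp add: continuous_map_def vimage_def)
qed

lemma continuous_map_into_weak_topology: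
  assumes "P \<noteq> {}" and cont: "\<And>f. f \<in> P \<Longrightarrow> continuous_map X euclidean (\<lambda>x. f (g x))"
  shows "continuous_map X (weak_topology P) g"
  unfolding weak_topology_def continuous_on_generated_topo_iff
proof (intro conjI allI impI)
  fix V assume "V \<in> {f -` U |f U. f \<in> P \<and> open U}"
  then obtain f U where f: "f \<in> P" and V: "V = f -` U" "open U"
    by blast
  have "openin X {x \<in> topspace X. f (g x) \<in> U}"
    using cont[OF f] by (rule openin_continuous_map_preimage) (simp add: V)
  moreover have "{x \<in> topspace X. f (g x) \<in> U} = g -` V \<inter> topspace X"
    using V by auto
  ultimately show "openin X (g -` V \<inter> topspace X)"
    by simp
next
  show "g ` topspace X \<subseteq> \<Union> {f -` U |f U. f \<in> P \<and> open U}"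
    using \<open>P \<noteq> {}\<close> by (auto intro!: exI[of _ UNIV])
qed


section \<open>Weak-star cluster points and monotone limits\<close>

context comm_wstar_algebra
begin

lemma predual_linear:
  assumes "f \<in> P"
  shows "f (x + y) = f x + f y" "f (of_scalar c * x) = c * f x"
  using assms predual_subset
  by (auto simp: dual_def bounded_clinear_def clinear_iff scaleC_complex_def simp flip: scaleC_conv_mult)

lemma predual_zero_eq: "f \<in> P \<Longrightarrow> f 0 = 0"
  using predual_linear(2)[of f 0 0] by simp

lemma predual_bound:
  assumes f: "f \<in> P"
  shows "cmod (f x) \<le> dual_norm nrm f * nrm x"
proof (cases "x = 0")
  case True
  then show ?thesis using predual_zero_eq[OF f] by simp
next
  case False
  then have x: "nrm x > 0"
    using nrm_nonneg[of x] nrm_eq_0[of x] by linarith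
  obtain C where C: "\<And>y. cmod (f y) \<le> C * nrm y"
    using f predual_subset by (auto simp: dual_def bounded_clinear_def)
  have "cmod (f y) \<le> \<bar>C\<bar>" if "nrm y \<le> 1" for y
  proof -
    have "C * nrm y \<le> \<bar>C\<bar> * 1"
      using that by (intro mult_mono) auto
    then show ?thesis
      using C[of y] by linarith
  qed
  then have bdd: "bdd_above ((\<lambda>y. cmod (f y)) ` {y. nrm y \<le> 1})"
    by (auto intro!: bdd_aboveI2)
  define y where "y = of_r (1 / nrm x) * x"
  have "nrm y \<le> 1"
    using x by (simp add: y_def nrm_of_r_mult)
  then have "cmod (f y) \<le> dual_norm nrm f"
    unfolding dual_norm_def by (intro cSUP_upper bdd) auto
  moreover have "f y = of_real (1 / nrm x) * f x"
    unfolding y_def of_r_def by (rule predual_linear[OF f])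
  ultimately show ?thesis
    using x by (simp add: norm_mult norm_divide field_simps)
qed

lemma nrm_le_predual:
  assumes "\<And>f. f \<in> P \<Longrightarrow> dual_norm nrm f \<le> 1 \<Longrightarrow> cmod (f x) \<le> r"
  shows "nrm x \<le> r"
proof -
  have "dual_norm nrm (\<lambda>x. 0) = (SUP x\<in>{x. nrm x \<le> 1}. 0)"
    by (simp add: dual_norm_def)
  also have "\<dots> = 0"
    by (rule cSUP_const) (auto intro!: exI[of _ 0])
  finally have ne: "{f \<in> P. dual_norm nrm f \<le> 1} \<noteq> {}"
    using predual_zero by force
  show ?thesis
    unfolding predual_isometric[of x] using assms by (intro cSUP_least[OF ne]) auto
qed

text \<open>A w*-cluster point would be approached under finitely many functionals at once. Here
  each functional is tested separately, which is the form that the norm estimate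
  \<open>cluster_nrm_le\<close> uses.\<close>

definition cluster :: "(nat \<Rightarrow> 'a) \<Rightarrow> 'a \<Rightarrow> bool" where
  "cluster x y \<longleftrightarrow> (\<forall>f\<in>P. \<forall>e>0. \<forall>N. \<exists>n\<ge>N. cmod (f (x n) - f y) < e)"

text \<open>The Banach-Alaoglu argument: evaluation sends the sequence into a product of closed
  discs, compact by Tychonoff. A cluster point there is linear and bounded on \<open>P\<close>,
  hence comes from an element by \<open>predual_onto\<close>.\<close>

lemma bounded_sequence_cluster:
  assumes x: "\<And>n. nrm (x n) \<le> C"
  obtains y where "cluster x y"
proof -
  \<comment> \<open>Coordinates outside \<open>P\<close> are fixed at 0, so that the product
    \<open>K\<close> ranges over the whole function type.\<close>
  define \<phi> where "\<phi> n f = (if f \<in> P then f (x n) else 0)" for n f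
  define S where "S f = (if f \<in> P then cball 0 (dual_norm nrm f * C) else {0::complex})" for f
  define K where "K = PiE UNIV S"
  have "compactin (product_topology (\<lambda>f. euclidean) UNIV) K"
    unfolding K_def compactin_PiE by (auto simp: S_def)
  then have "compact K"
    by (simp add: euclidean_product_topology)
  moreover have "\<phi> n \<in> K" for n
  proof -
    have "f \<in> P \<Longrightarrow> cmod (f (x n)) \<le> dual_norm nrm f * C" for f
    proof -
      assume f: "f \<in> P"
      have "0 \<le> dual_norm nrm f"
        using predual_bound[OF f, of 1] order_trans[OF norm_ge_zero] by simp
      then show "cmod (f (x n)) \<le> dual_norm nrm f * C"
        by (rule order_trans[OF predual_bound[OF f] mult_left_mono[OF x]])
    qed
    then show ?thesis
      by (auto simp: K_def S_def \<phi>_def)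
  qed
  moreover have "filtermap \<phi> sequentially \<noteq> bot"
    by (simp add: filtermap_bot_iff)
  moreover from calculation have "\<forall>\<^sub>F \<psi> in filtermap \<phi> sequentially. \<psi> \<in> K"
    by (simp add: eventually_filtermap)
  ultimately obtain L where L: "L \<in> K" "inf (nhds L) (filtermap \<phi> sequentially) \<noteq> bot"
    unfolding compact_filter by blast
  \<comment> \<open>Three coordinates at once, because additivity of \<open>L\<close> compares its
    values at f, g and f + g.\<close>
  have near: "\<exists>n\<ge>N. cmod (\<phi> n f - L f) < e \<and> cmod (\<phi> n g - L g) < e \<and> cmod (\<phi> n h - L h) < e"
    if "e > 0" for f g h e N
  proof -
    let ?I = "inf (nhds L) (filtermap \<phi> sequentially)"
    have *: "\<forall>\<^sub>F \<psi> in ?I. cmod (\<psi> f - L f) < e" for f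
    proof -
      have "continuous_on UNIV (\<lambda>\<psi>. \<psi> f :: complex)"
        by (rule continuous_on_product_coordinates)
      then have "((\<lambda>\<psi>. \<psi> f) \<longlongrightarrow> L f) (at L)"
        unfolding continuous_on_def by blast
      then have "((\<lambda>\<psi>. \<psi> f) \<longlongrightarrow> L f) (nhds L)"
        using tendsto_at_iff_tendsto_nhds[of "\<lambda>\<psi>. \<psi> f" L] by blast
      then have "\<forall>\<^sub>F \<psi> in nhds L. dist (\<psi> f) (L f) < e"
        using that by (rule tendstoD)
      then show ?thesis
        by (simp add: dist_norm filter_leD[OF inf_le1])
    qed
    have "\<forall>\<^sub>F \<psi> in filtermap \<phi> sequentially. \<exists>n\<ge>N. \<psi> = \<phi> n"
      unfolding eventually_filtermap eventually_sequentially by blast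
    then have "\<forall>\<^sub>F \<psi> in ?I. \<exists>n\<ge>N. \<psi> = \<phi> n"
      by (rule filter_leD[OF inf_le2])
    with *[of f] *[of g] *[of h]
    have "\<forall>\<^sub>F \<psi> in ?I. (\<exists>n\<ge>N. \<psi> = \<phi> n) \<and> cmod (\<psi> f - L f) < e \<and> cmod (\<psi> g - L g) < e
        \<and> cmod (\<psi> h - L h) < e"
      by (intro eventually_conj)
    from eventually_happens'[OF L(2) this] show ?thesis
      by blast
  qed
  have "\<exists>y. \<forall>f\<in>P. L f = f y"
  proof (rule predual_onto[where C = C])
    fix f g assume fg: "f \<in> P" "g \<in> P"
    let ?h = "\<lambda>x. f x + g x"
    have "cmod (L ?h - (L f + L g)) \<le> 0 + e" if "e > 0" for e
    proof -
      from that have "e / 3 > 0" by simp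
      from near[OF this, of 0 f g ?h] obtain n where
        n: "cmod (\<phi> n f - L f) < e / 3" "cmod (\<phi> n g - L g) < e / 3" "cmod (\<phi> n ?h - L ?h) < e / 3"
        by blast
      have "\<phi> n ?h = \<phi> n f + \<phi> n g"
        using fg predual_add by (simp add: \<phi>_def)
      then have "L ?h - (L f + L g) = (\<phi> n f - L f) + (\<phi> n g - L g) - (\<phi> n ?h - L ?h)"
        by simp
      also have "cmod \<dots> \<le> cmod (\<phi> n f - L f) + cmod (\<phi> n g - L g) + cmod (\<phi> n ?h - L ?h)"
        using norm_triangle_ineq4[of "(\<phi> n f - L f) + (\<phi> n g - L g)" "\<phi> n ?h - L ?h"]
          norm_triangle_ineq[of "\<phi> n f - L f" "\<phi> n g - L g"] by linarith
      finally show ?thesis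
        using n by linarith
    qed
    then have "cmod (L ?h - (L f + L g)) \<le> 0"
      by (rule field_le_epsilon)
    then show "L ?h = L f + L g"
      by simp
  next
    fix c f assume f: "f \<in> P"
    let ?h = "\<lambda>x. c * f x"
    have "cmod (L ?h - c * L f) \<le> 0 + e" if "e > 0" for e
    proof -
      define d where "d = e / (1 + cmod c)"
      have "1 + cmod c > 0"
        by (simp add: add_pos_nonneg)
      then have "d > 0" and d: "d * (1 + cmod c) = e"
        using that by (simp_all add: d_def)
      from near[OF \<open>d > 0\<close>, of 0 f f ?h] obtain n where
        n: "cmod (\<phi> n f - L f) < d" "cmod (\<phi> n ?h - L ?h) < d"
        by blast
      have "\<phi> n ?h = c * \<phi> n f"
        using f predual_scale by (simp add: \<phi>_def)
      then have "L ?h - c * L f = c * (\<phi> n f - L f) - (\<phi> n ?h - L ?h)"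
        by (simp add: algebra_simps)
      also have "cmod \<dots> \<le> cmod c * cmod (\<phi> n f - L f) + cmod (\<phi> n ?h - L ?h)"
        unfolding norm_mult[symmetric] by (rule norm_triangle_ineq4)
      also have "\<dots> \<le> cmod c * d + d"
        using n by (intro add_mono mult_left_mono) auto
      finally show ?thesis
        using d by (simp add: algebra_simps)
    qed
    then have "cmod (L ?h - c * L f) \<le> 0"
      by (rule field_le_epsilon)
    then show "L ?h = c * L f"
      by simp
  next
    fix f assume "f \<in> P"
    have "L f \<in> S f"
      using L(1) by (auto simp: K_def)
    then show "cmod (L f) \<le> C * dual_norm nrm f"
      using \<open>f \<in> P\<close> by (simp add: S_def mult.commute)
  qed
  then obtain y where y: "\<And>f. f \<in> P \<Longrightarrow> L f = f y"
    by blast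
  have "cluster x y"
    unfolding cluster_def
  proof (intro ballI allI impI)
    fix f e N assume f: "f \<in> P" and "(0::real) < e"
    from near[OF this(2), of N f f f] show "\<exists>n\<ge>N. cmod (f (x n) - f y) < e"
      using f y[OF f] by (auto simp: \<phi>_def)
  qed
  then show ?thesis by (rule that)
qed

text \<open>Norm balls are w*-closed. The shift \<open>c\<close> serves the bounds behind
  \<open>pos\<close>, and \<open>N\<close> serves those that hold only on a tail, such as positivity
  of x m - x n for n \<ge> m.\<close>

lemma cluster_nrm_le:
  assumes "cluster x y" "\<And>n. n \<ge> N \<Longrightarrow> nrm (c + x n) \<le> r"
  shows "nrm (c + y) \<le> r"
proof (rule nrm_le_predual)
  fix f assume f: "f \<in> P" "dual_norm nrm f \<le> 1"
  show "cmod (f (c + y)) \<le> r"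
  proof (rule field_le_epsilon)
    fix e :: real assume "e > 0"
    then obtain n where n: "n \<ge> N" "cmod (f (x n) - f y) < e"
      using assms(1)[unfolded cluster_def, rule_format, OF f(1), of e N] by blast
    have "cmod (f (c + x n)) \<le> dual_norm nrm f * nrm (c + x n)"
      by (rule predual_bound[OF f(1)])
    also have "\<dots> \<le> 1 * nrm (c + x n)"
      using f(2) by (intro mult_right_mono) auto
    also have "\<dots> \<le> r"
      using assms(2)[OF n(1)] by simp
    finally have "cmod (f (c + x n)) \<le> r" .
    moreover have eq: "f (c + y) = f (c + x n) - (f (x n) - f y)"
      by (simp add: predual_linear[OF f(1)])
    ultimately show "cmod (f (c + y)) \<le> r + e"
      unfolding eq using norm_triangle_ineq4[of "f (c + x n)" "f (x n) - f y"] n(2) by linarith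
  qed
qed

text \<open>The imaginary part \<open>b\<close> of the cluster point satisfies \<open>nrm (b + t) \<le> sqrt (C\<^sup>2 + t\<^sup>2)\<close>
  for every real \<open>t\<close>; letting \<open>t\<close> tend to \<open>\<plusminus>\<infinity>\<close> gives \<open>b = 0\<close>.\<close>
lemma cluster_selfadjoint:
  assumes x: "\<And>n. selfadjoint (x n)" "\<And>n. nrm (x n) \<le> C" and y: "cluster x y"
  shows "selfadjoint y"
proof -
  obtain a b where ab: "selfadjoint a" "selfadjoint b" "y = a + imag_unit * b"
    using cartesian_decomposition .
  have "0 \<le> C"
    using order_trans[OF nrm_nonneg x(2)] .
  have bt: "nrm (b + of_r t) \<le> sqrt (C\<^sup>2 + t\<^sup>2)" for t
  proof -
    have "nrm (imag_unit * of_r t + x n) \<le> sqrt (C\<^sup>2 + t\<^sup>2)" for n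
    proof -
      have "(nrm (x n + imag_unit * of_r t))\<^sup>2 = nrm (x n * x n + of_r t * of_r t)"
        using x(1) by (intro nrm_cartesian) auto
      also have "\<dots> \<le> (nrm (x n))\<^sup>2 + \<bar>t * t\<bar>"
        using nrm_triangle[of "x n * x n" "of_r t * of_r t"] nrm_of_r[of "t * t"]
        unfolding of_r_mult nrm_square[OF x(1)] by linarith
      also have "\<dots> \<le> C\<^sup>2 + t\<^sup>2"
        using power_mono[OF x(2)[of n], of 2] by (simp add: power2_eq_square[of t])
      finally show ?thesis
        unfolding add.commute[of "imag_unit * of_r t"] by (rule real_le_rsqrt)
    qed
    then have "nrm (imag_unit * of_r t + y) \<le> sqrt (C\<^sup>2 + t\<^sup>2)"
      using cluster_nrm_le[OF y, of 0] by blast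
    moreover have "imag_unit * of_r t + y = a + imag_unit * (b + of_r t)"
      by (simp add: ab(3) distrib_left)
    moreover have "(nrm (b + of_r t))\<^sup>2 \<le> (nrm (a + imag_unit * (b + of_r t)))\<^sup>2"
      using nrm_square_le_sum_squares[of "b + of_r t" a] ab
      by (simp add: nrm_cartesian add.commute[of "a * a"])
    then have "nrm (b + of_r t) \<le> nrm (a + imag_unit * (b + of_r t))"
      by (rule power2_le_imp_le) simp
    ultimately show ?thesis
      by (metis order_trans)
  qed
  have "pos (b + of_r e)" and "pos (- b + of_r e)" if "e > 0" for e
  proof -
    \<comment> \<open>With t e = C^2 the square (t + e)^2 dominates C^2 + t^2, so the bound
      \<open>bt\<close> at t and -t is within e of t.\<close>
    define t where "t = C\<^sup>2 / e"
    have t: "0 \<le> t" "t * e = C\<^sup>2"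
      using that by (simp_all add: t_def)
    have "C\<^sup>2 + t\<^sup>2 \<le> t\<^sup>2 + e\<^sup>2 + 2 * (t * e)"
      unfolding t(2) by simp
    also have "\<dots> = (t + e)\<^sup>2"
      by (simp only: power2_sum mult.assoc)
    finally have t: "sqrt (C\<^sup>2 + t\<^sup>2) \<le> t + e"
      using t(1) that by (intro real_le_lsqrt) simp_all
    have "pos (of_r (t + e) + (b + of_r (- t)))"
      using bt[of "- t"] t ab(2) by (intro nrm_le_imp_pos_diff(2)) auto
    then show "pos (b + of_r e)"
      by (simp add: of_r_add of_r_minus algebra_simps)
    have "pos (of_r (t + e) - (b + of_r t))"
      using bt[of t] t ab(2) by (intro nrm_le_imp_pos_diff(1)) auto
    then show "pos (- b + of_r e)"
      by (simp add: of_r_add algebra_simps)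
  qed
  then have "pos b" and "pos (- b)"
    using ab(2) by (simp_all add: pos_eps)
  then have "b = 0"
    by (rule pos_antisym)
  then show ?thesis
    using ab by simp
qed

text \<open>The infimum is a cluster point. By \<open>pos_nrm_diff_le\<close> every inequality
  between the sequence and a fixed element is a norm bound with a radius independent of n, so it
  passes to the cluster point.\<close>

lemma decreasing_sequence_infimum:
  assumes x: "\<And>n. pos (x n)" and dec: "\<And>n. pos (x n - x (Suc n))"
  obtains g where "pos g" "\<And>n. pos (x n - g)"
    "\<And>y. selfadjoint y \<Longrightarrow> \<forall>n. pos (x n - y) \<Longrightarrow> pos (g - y)"
proof -
  have diff: "pos (x m - x n)" if "m \<le> n" for m n
    using that
  proof (induction n rule: dec_induct)
    case (step n)
    then show ?case
      using pos_add[OF step.IH dec[of n]] by simp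
  qed simp
  define R where "R = nrm (x 0)"
  have R: "nrm (x n) \<le> R" for n
  proof (rule pos_nrm_le)
    have "pos (of_r R - x 0)"
      using x[of 0] by (intro nrm_le_imp_pos_diff) (simp_all add: R_def pos_selfadjoint)
    then show "pos (of_r R - x n)"
      using pos_add[OF _ diff[of 0 n], of "of_r R - x 0"] by simp
  qed (simp_all add: x R_def)
  obtain g where g: "cluster x g"
    using bounded_sequence_cluster[OF R] .
  have sa: "selfadjoint g"
    using cluster_selfadjoint[OF pos_selfadjoint[OF x] R g] .
  have upper: "pos (g - y)" if y: "selfadjoint y" "\<forall>n. pos (x n - y)" for y
  proof (rule posI)
    let ?r = "R + nrm y"
    have b: "nrm (of_r ?r - (x n - y)) \<le> ?r" for n
      using nrm_diff_le[of "x n" y] R[of n] by (intro pos_nrm_diff_le y(2)[rule_format]) auto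
    \<comment> \<open>In \<open>cluster_nrm_le\<close> the sequence enters with a plus sign, hence
      the negated form.\<close>
    have eq: "- of_r ?r - y + z = - (of_r ?r - (z - y))" for z
      by simp
    have "nrm (- of_r ?r - y + x n) \<le> ?r" for n
      by (simp only: eq nrm_minus b)
    then have "nrm (- of_r ?r - y + g) \<le> ?r"
      using cluster_nrm_le[OF g, of 0] by blast
    then show "nrm (of_r ?r - (g - y)) \<le> ?r"
      unfolding eq nrm_minus .
    show "0 \<le> ?r"
      by (simp add: R_def)
  qed (use sa y in simp)
  moreover have "pos g"
    using upper[of 0] x by simp
  moreover have "pos (x m - g)" for m
  proof (rule posI)
    have "nrm (of_r (2 * R) - (x m - x n)) \<le> 2 * R" if "n \<ge> m" for n
      using nrm_diff_le[of "x m" "x n"] R[of m] R[of n] diff[OF that] by (intro pos_nrm_diff_le) auto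
    then have "nrm ((of_r (2 * R) - x m) + x n) \<le> 2 * R" if "n \<ge> m" for n
      using that by (simp add: algebra_simps)
    then have "nrm ((of_r (2 * R) - x m) + g) \<le> 2 * R"
      using cluster_nrm_le[OF g] by blast
    then show "nrm (of_r (2 * R) - (x m - g)) \<le> 2 * R"
      by (simp add: algebra_simps)
    show "0 \<le> 2 * R"
      by (simp add: R_def)
  qed (use sa x in \<open>simp add: pos_selfadjoint\<close>)
  ultimately show ?thesis
    using that by blast
qed

end

section \<open>Spectral projections\<close>

lemma projection_mult [simp]: "p \<in> projections \<Longrightarrow> p * p = p"
  unfolding projections_def by blast

lemma projection_selfadjoint: "p \<in> projections \<Longrightarrow> selfadjoint p"
  unfolding projections_def selfadjoint_def by blast

context comm_wstar_algebra
begin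

lemma projection_pos:
  assumes "p \<in> projections"
  shows "pos p" "pos (1 - p)"
proof -
  show "pos p"
    using pos_square[OF projection_selfadjoint[OF assms]] assms by simp
  have "(1 - p) * (1 - p) = 1 - p"
    using assms by (simp add: algebra_simps)
  then show "pos (1 - p)"
    using pos_square[of "1 - p"] projection_selfadjoint[OF assms] by simp
qed

text \<open>In function terms \<open>g\<close> is the indicator of \<open>{d = 1}\<close>, obtained as the infimum of the
  powers of \<open>d\<close>.  Summing \<open>(1 - d) g \<le> (1 - d) d\<^sup>k\<close> over \<open>k < n\<close> gives
  \<open>n (1 - d) g \<le> 1\<close>, hence \<open>d g = g\<close>; and \<open>2 g - g\<^sup>2\<close> is a lower bound of the powers, hence
  \<open>g \<le> g\<^sup>2\<close>.\<close>
lemma fixed_projection: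
  assumes d: "pos d" "pos (1 - d)"
  obtains g where "g \<in> projections" "g * d = g"
    "\<And>y. selfadjoint y \<Longrightarrow> \<forall>n. pos (d ^ n - y) \<Longrightarrow> pos (g - y)"
proof -
  have pow: "pos (d ^ n)" for n
    by (induction n) (simp_all add: d pos_mult)
  have dec: "pos (d ^ n - d ^ Suc n)" for n
    using pos_mult[OF pow[of n] d(2)] by (simp add: algebra_simps)
  obtain g where g: "pos g" "\<And>n. pos (d ^ n - g)"
    "\<And>y. selfadjoint y \<Longrightarrow> \<forall>n. pos (d ^ n - y) \<Longrightarrow> pos (g - y)"
    using decreasing_sequence_infimum[of "\<lambda>n. d ^ n", OF pow dec] by blast
  define a where "a = (1 - d) * g"
  have a: "pos a"
    unfolding a_def using d(2) g(1) by (rule pos_mult)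
  have sum: "pos (1 - d ^ n - of_r (real n) * a)" for n
  proof (induction n)
    case (Suc n)
    have eq: "1 - d ^ Suc n - of_r (real (Suc n)) * a
        = (1 - d ^ n - of_r (real n) * a) + (1 - d) * (d ^ n - g)"
      by (simp add: of_r_add a_def algebra_simps)
    show ?case
      unfolding eq by (intro pos_add Suc pos_mult d g(2))
  qed simp
  have bound: "real n * nrm a \<le> 1" for n
  proof -
    have "pos (of_r 1 - of_r (real n) * a)"
      using pos_add[OF sum[of n] pow[of n]] by simp
    then have "nrm (of_r (real n) * a) \<le> 1"
      using a by (intro pos_nrm_le pos_scale) auto
    then show ?thesis
      by (simp add: nrm_of_r_mult)
  qed
  have "nrm a = 0"
  proof (rule ccontr)
    assume "nrm a \<noteq> 0"
    then have "nrm a > 0"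
      using nrm_nonneg[of a] by linarith
    then obtain n where "1 < real n * nrm a"
      using reals_Archimedean3 by blast
    then show False
      using bound[of n] by simp
  qed
  then have "g - g * d = 0"
    by (simp add: nrm_eq_0 a_def right_diff_distrib mult.commute)
  then have gd: "g * d = g"
    by (simp only: right_minus_eq)
  have gdn: "g * d ^ n = g" for n
  proof (induction n)
    case (Suc n)
    have "g * d ^ Suc n = (g * d) * d ^ n"
      by (simp only: power_Suc mult.assoc)
    then show ?case
      by (simp only: gd Suc)
  qed simp
  \<comment> \<open>This is positivity of (1 - g)^2 d^n, expanded with \<open>gdn\<close>.\<close>
  have low: "pos (d ^ n - (g + g - g * g))" for n
  proof -
    have "(1 - g) * (1 - g) * d ^ n = d ^ n - g * d ^ n - g * d ^ n + g * (g * d ^ n)"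
      by (simp add: algebra_simps)
    also have "\<dots> = d ^ n - (g + g - g * g)"
      by (simp only: gdn) simp
    finally have eq: "d ^ n - (g + g - g * g) = (1 - g) * (1 - g) * d ^ n" ..
    show ?thesis
      unfolding eq using g(1) by (intro pos_mult[OF pos_square pow]) (simp add: pos_selfadjoint)
  qed
  have "selfadjoint (g + g - g * g)"
    using pos_selfadjoint[OF g(1)] by (intro selfadjoint_add selfadjoint_diff selfadjoint_mult)
  from this allI[OF low] have "pos (g - (g + g - g * g))"
    by (rule g(3))
  then have "pos (g * g - g)"
    by (simp add: algebra_simps)
  moreover have "pos (- (g * g - g))"
    using pos_mult[OF g(1) g(2)[of 0]] by (simp add: algebra_simps)
  ultimately have "g * g = g"
    using pos_antisym right_minus_eq by blast
  then have "g \<in> projections"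
    using pos_selfadjoint[OF g(1)] unfolding projections_def selfadjoint_def by blast
  then show ?thesis
    by (rule that[OF _ gd g(3)])
qed

text \<open>Writing \<open>k = |h|\<close>, the squares of \<open>k - h\<close> and \<open>k + h\<close> are orthogonal and positive;
  \<open>g\<close> is chosen to annihilate the former and to dominate the latter.\<close>
lemma sign_projection:
  assumes h: "selfadjoint h"
  obtains g where "g \<in> projections" "pos (g * h)" "pos (- ((1 - g) * h))"
proof -
  obtain k where k: "pos k" "k * k = h * h"
    using pos_square_root[OF pos_square[OF h]] .
  define a b where "a = (k - h) * (k - h)" and "b = (k + h) * (k + h)"
  have ksa: "selfadjoint k"
    using k(1) by (rule pos_selfadjoint)
  have ab: "pos a" "pos b"
    unfolding a_def b_def using h ksa by (simp_all add: pos_square)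
  have "a * b = ((k - h) * (k + h)) * ((k - h) * (k + h))"
    unfolding a_def b_def by (simp only: ac_simps)
  also have "(k - h) * (k + h) = 0"
    using k(2) by (simp add: algebra_simps)
  finally have orth: "a * b = 0" by simp
  \<comment> \<open>Scaling a and b into the unit ball makes 1 - a' and 1 - b' positive; the summand
    1 keeps \<open>R\<close> nonzero.\<close>
  define R where "R = nrm a + nrm b + 1"
  have R: "R > 0" "nrm a \<le> R" "nrm b \<le> R"
    using nrm_nonneg[of a] nrm_nonneg[of b] unfolding R_def by linarith+
  define a' b' where "a' = of_r (1 / R) * a" and "b' = of_r (1 / R) * b"
  have ab': "pos a'" "pos b'" "nrm a' \<le> 1" "nrm b' \<le> 1"
    using ab R by (simp_all add: a'_def b'_def pos_scale nrm_of_r_mult)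
  have R_cancel: "z * x = 0" if "z * (of_r (1 / R) * x) = 0" for x z :: 'a
  proof -
    have "z * x = of_r (R * (1 / R)) * (z * x)"
      using R by simp
    also have "\<dots> = of_r R * (z * (of_r (1 / R) * x))"
      unfolding of_r_mult by (simp only: mult.assoc mult.left_commute[of z])
    finally show ?thesis
      by (simp only: that mult_zero_right)
  qed
  have one_diff: "pos (1 - a')" "pos (1 - b')"
    using nrm_le_imp_pos_diff(1)[of a' 1] nrm_le_imp_pos_diff(1)[of b' 1] ab' by (simp_all add: pos_selfadjoint)
  have "a' * b' = of_r (1 / R) * (of_r (1 / R) * (a * b))"
    by (simp only: a'_def b'_def ac_simps)
  then have orth': "a' * b' = 0"
    by (simp add: orth)
  \<comment> \<open>In function terms g is the indicator of {a' = 0} = {k = h} = {h \<ge>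
    0}.\<close>
  obtain g where g: "g \<in> projections" "g * (1 - a') = g"
    "\<And>y. selfadjoint y \<Longrightarrow> \<forall>n. pos ((1 - a') ^ n - y) \<Longrightarrow> pos (g - y)"
    using fixed_projection[of "1 - a'"] one_diff(1) ab'(1) unfolding diff_diff_eq2 add_diff_cancel_left' by blast
  have gsa: "selfadjoint g"
    using g(1) by (rule projection_selfadjoint)
  have "g * a' = g - g * (1 - a')"
    by (simp add: right_diff_distrib)
  then have "g * a' = 0"
    by (simp only: g(2) diff_self)
  then have "g * a = 0"
    unfolding a'_def by (rule R_cancel)
  moreover have "(g * (k - h)) * (g * (k - h)) = (g * g) * a"
    unfolding a_def by (simp only: ac_simps)
  ultimately have "(g * (k - h)) * (g * (k - h)) = 0"
    by (simp only: projection_mult[OF g(1)])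
  then have "g * (k - h) = 0"
    by (rule square_eq_0[rotated]) (intro selfadjoint_mult selfadjoint_diff gsa ksa h)
  then have gh: "g * h = g * k"
    by (simp only: right_diff_distrib right_minus_eq)
  have bd: "(1 - a') ^ n * b' = b'" for n
  proof (induction n)
    case (Suc n)
    have "(1 - a') ^ Suc n * b' = (1 - a') * ((1 - a') ^ n * b')"
      by (simp only: power_Suc mult.assoc)
    also have "\<dots> = b'"
      unfolding Suc using orth' by (simp add: left_diff_distrib)
    finally show ?case .
  qed simp
  \<comment> \<open>By orthogonality (1 - a')^n b' = b', so (1 - a')^n - b' = (1 - a')^n (1 - b') is
    positive: b' is a lower bound of the powers.\<close>
  have "pos (g - b')"
  proof (rule g(3), safe)
    show "selfadjoint b'"
      using ab' by (simp add: pos_selfadjoint)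
    fix n
    have pow: "pos ((1 - a') ^ n)"
      by (induction n) (simp_all add: one_diff pos_mult)
    have "pos ((1 - a') ^ n * (1 - b'))"
      by (intro pos_mult pow one_diff)
    then show "pos ((1 - a') ^ n - b')"
      by (simp add: right_diff_distrib bd)
  qed
  \<comment> \<open>The factor 1 - g kills g and leaves the negative of (1 - g) b', which is itself
    positive. So (1 - g) b' = 0, and this forces h = -k on the complement of g.\<close>
  then have "pos ((1 - g) * (g - b'))"
    using projection_pos(2)[OF g(1)] by (intro pos_mult)
  moreover have "(1 - g) * (g - b') = - ((1 - g) * b')"
    using g(1) by (simp add: algebra_simps)
  ultimately have "pos (- ((1 - g) * b'))"
    by simp
  moreover have "pos ((1 - g) * b')"
    using projection_pos(2)[OF g(1)] ab' by (intro pos_mult)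
  ultimately have "(1 - g) * b' = 0"
    by (intro pos_antisym)
  then have "(1 - g) * b = 0"
    unfolding b'_def by (rule R_cancel)
  moreover have "((1 - g) * (k + h)) * ((1 - g) * (k + h)) = (1 - g) * ((1 - g) * b)"
    unfolding b_def by (simp only: ac_simps)
  ultimately have "((1 - g) * (k + h)) * ((1 - g) * (k + h)) = 0"
    by (simp only: mult_zero_right)
  then have "(1 - g) * (k + h) = 0"
    by (rule square_eq_0[rotated])
      (intro selfadjoint_mult selfadjoint_add selfadjoint_diff selfadjoint_simps gsa ksa h)
  then have "- ((1 - g) * h) = (1 - g) * k"
    unfolding distrib_left by (simp only: eq_neg_iff_add_eq_0 neg_eq_iff_add_eq_0 add.commute)
  then have "pos (- ((1 - g) * h))"
    using pos_mult[OF projection_pos(2)[OF g(1)] k(1)] by simp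
  moreover have "pos (g * h)"
    unfolding gh using projection_pos(1)[OF g(1)] k(1) by (rule pos_mult)
  ultimately show ?thesis
    using that g(1) by blast
qed

text \<open>Subtracting half of the symmetry \<open>2 g - 1\<close>, scaled by the norm, from a selfadjoint element
  with sign projection \<open>g\<close> halves its norm: the values of the functional are those on
  arbitrarily small elements.\<close>
lemma bounded_functional_eq_0:
  assumes add: "\<And>x y. D (x + y) = D x + (D y :: complex)"
    and scale: "\<And>c x. D (of_scalar c * x) = c * D x"
    and bound: "\<And>x. cmod (D x) \<le> C * nrm x"
    and proj: "\<And>p. p \<in> projections \<Longrightarrow> D p = 0"
  shows "D x = 0"
proof -
  have D0: "D 0 = 0"
    using scale[of 0 0] by simp
  have minus: "D (- x) = - D x" for x
    using add[of x "- x"] D0 by (simp add: eq_neg_iff_add_eq_0 add.commute)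
  have D1: "D 1 = 0"
  proof (rule proj)
    show "1 \<in> projections"
      unfolding projections_def by (intro CollectI conjI adj_one mult_1_left)
  qed
  have small: "cmod (D h) \<le> C * nrm h / 2 ^ n" if "selfadjoint h" for h n
    using that
  proof (induction n arbitrary: h)
    case (Suc n)
    note h = \<open>selfadjoint h\<close>
    obtain g where g: "g \<in> projections" "pos (g * h)" "pos (- ((1 - g) * h))"
      using sign_projection[OF h] .
    define R where "R = nrm h"
    have Rh: "pos (of_r R - h)" "pos (of_r R + h)"
      using h by (simp_all add: R_def nrm_le_imp_pos_diff)
    \<comment> \<open>On g the values of h lie in [0, R], off g in [-R, 0]; shifting these two
      intervals by -R/2 and R/2 centres both at 0. The functional does not see the shift, since it
      vanishes at g and at 1.\<close>
    define h' where "h' = h - of_r R * g + of_r (R / 2)"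
    have two: "of_r R = of_r (R / 2) + (of_r (R / 2) :: 'a)"
      by (simp flip: of_r_add)
    have sa: "selfadjoint h'"
      unfolding h'_def using h projection_selfadjoint[OF g(1)]
      by (intro selfadjoint_add selfadjoint_diff selfadjoint_mult selfadjoint_simps)
    have e1: "of_r (R / 2) - h' = g * (of_r R - h) + - ((1 - g) * h)"
      by (simp add: h'_def algebra_simps)
    have e2: "of_r (R / 2) + h' = (1 - g) * (of_r R + h) + g * h"
      using two by (simp add: h'_def algebra_simps)
    have "nrm h' \<le> R / 2"
    proof (rule nrm_le_iff_pos[OF sa])
      show "pos (of_r (R / 2) - h')"
        unfolding e1 by (intro pos_add pos_mult g Rh projection_pos)
      show "pos (of_r (R / 2) + h')"
        unfolding e2 by (intro pos_add pos_mult g Rh projection_pos)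
    qed (simp add: R_def)
    have C: "0 \<le> C"
      using order_trans[OF norm_ge_zero bound[of 1]] by simp
    have "D (of_r r * y) = of_real r * D y" for r y
      unfolding of_r_def by (rule scale)
    from this[of _ 1] this[of _ g] have "D h' = D h"
      using proj[OF g(1)] D1
      unfolding h'_def diff_conv_add_uminus add minus by simp
    then have "cmod (D h) \<le> C * nrm h' / 2 ^ n"
      using Suc.IH[OF sa] by simp
    also have "\<dots> \<le> C * (R / 2) / 2 ^ n"
      using C \<open>nrm h' \<le> R / 2\<close> by (intro divide_right_mono mult_left_mono) auto
    finally show ?case
      by (simp add: R_def)
  qed (use bound in simp)
  have sa: "D h = 0" if "selfadjoint h" for h
  proof -
    have "(\<lambda>n. (1 / 2) ^ n) \<longlonglongrightarrow> (0::real)"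
      by (intro LIMSEQ_power_zero) simp
    then have "(\<lambda>n. C * nrm h * (1 / 2) ^ n) \<longlonglongrightarrow> 0"
      by (rule tendsto_mult_right_zero)
    moreover have "cmod (D h) \<le> C * nrm h * (1 / 2) ^ n" for n
      using small[OF that, of n] by (simp add: power_one_over)
    ultimately have "cmod (D h) \<le> 0"
      by (rule le_limit[rotated])
    then show ?thesis by simp
  qed
  obtain a b where "selfadjoint a" "selfadjoint b" "x = a + imag_unit * b"
    using cartesian_decomposition .
  then show ?thesis
    by (simp add: add scale sa)
qed

text \<open>For selfadjoint h and \<rho> > n h let g be the sign projection of h - \<rho>. If g were
  nonzero, then n g = 1 and \<rho> \<le> n (g h) \<le> n h; so g = 0, which means h \<le> \<rho>.
  The C*-identity of both norms reduces x to adj x * x.\<close>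

lemma nrm_le_cstar_norm:
  assumes "comm_cstar_norm n"
  shows "nrm x \<le> n x"
proof -
  interpret n: comm_cstar_norm n
    by fact
  have above: "pos (of_r \<rho> - h)" if h: "selfadjoint h" and \<rho>: "n h < \<rho>" for h \<rho>
  proof -
    obtain g where g: "g \<in> projections" "pos (g * (h - of_r \<rho>))" "pos (- ((1 - g) * (h - of_r \<rho>)))"
      using sign_projection[of "h - of_r \<rho>"] h by auto
    have "\<rho> > 0"
      using \<rho> n.nrm_nonneg[of h] by linarith
    have gsa: "selfadjoint g"
      using g(1) by (rule projection_selfadjoint)
    have "g = 0"
    proof (rule ccontr)
      assume "g \<noteq> 0"
      have "(n g)\<^sup>2 = n g"
        using n.nrm_square[OF gsa] g(1) by simp
      moreover have "n g \<noteq> 0"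
        using \<open>g \<noteq> 0\<close> by (simp add: n.nrm_eq_0)
      ultimately have "n g = 1"
        by (simp add: power2_eq_square)
      \<comment> \<open>The order is defined through \<open>nrm\<close>, not through
        \<open>n\<close>. Writing the positive element as a square lets
        \<open>n.nrm_square_le_sum_squares\<close> compare \<rho> g with g h in the norm
        \<open>n\<close>.\<close>
      obtain k where k: "pos k" "k * k = g * (h - of_r \<rho>)"
        using pos_square_root[OF g(2)] .
      define s where "s = sqrt \<rho>"
      have s: "s * s = \<rho>" "s > 0"
        using \<open>\<rho> > 0\<close> by (simp_all add: s_def)
      have "(n (of_r s * g))\<^sup>2 \<le> n ((of_r s * g) * (of_r s * g) + k * k)"
        using gsa k by (intro n.nrm_square_le_sum_squares) (auto simp: pos_selfadjoint)
      also have "(of_r s * g) * (of_r s * g) = of_r (s * s) * (g * g)"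
        unfolding of_r_mult by (simp only: ac_simps)
      also have "\<dots> + k * k = g * h"
        unfolding k s using g(1) by (simp add: algebra_simps)
      also have "(n (of_r s * g))\<^sup>2 = \<rho>"
        using s \<open>n g = 1\<close> by (simp add: n.nrm_of_r_mult power2_eq_square)
      finally have "\<rho> \<le> n (g * h)" .
      also have "\<dots> \<le> n h"
        using n.nrm_mult[of g h] \<open>n g = 1\<close> by simp
      finally show False
        using \<rho> by simp
    qed
    then show ?thesis
      using g(3) by simp
  qed
  have sa: "nrm h \<le> n h" if h: "selfadjoint h" for h
  proof (rule field_le_epsilon)
    fix e :: real assume "e > 0"
    then have "pos (of_r (n h + e) - h)" "pos (of_r (n h + e) + h)"
      using h above[of h "n h + e"] above[of "- h" "n h + e"] by simp_all
    then show "nrm h \<le> n h + e"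
      using h \<open>e > 0\<close> by (intro nrm_le_iff_pos) simp_all
  qed
  have "(nrm x)\<^sup>2 \<le> (n x)\<^sup>2"
    using sa[of "adj x * x"] by (simp add: nrm_cstar n.nrm_cstar selfadjoint_def adj_mult adj_adj)
  then show ?thesis
    by (rule power2_le_imp_le) simp
qed

text \<open>By induction over their generation, sets open in \<open>weak_topology P\<close> contain
  a norm ball about each of their points. So the modulus of D is below 1 on a ball about 0, and
  rescaling gives the bound that \<open>bounded_functional_eq_0\<close> asks for in the
  w*-continuous case.\<close>

lemma weakly_continuous_functional_bounded:
  assumes add: "\<And>x y. D (x + y) = D x + (D y :: complex)"
    and scale: "\<And>c x. D (of_scalar c * x) = c * D x"
    and cont: "continuous_map (weak_topology P) euclidean D"
  shows "\<exists>C. \<forall>x. cmod (D x) \<le> C * nrm x"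
proof -
  have nbhd: "\<exists>r>0. \<forall>y. nrm (y - x) < r \<longrightarrow> y \<in> V" if "openin (weak_topology P) V" "x \<in> V" for V x
    using that unfolding weak_topology_def openin_topology_generated_by_iff
  proof (induction V arbitrary: x rule: generate_topology_on.induct)
    case (Int V W)
    then obtain r s where "r > 0" "\<forall>y. nrm (y - x) < r \<longrightarrow> y \<in> V" "s > 0" "\<forall>y. nrm (y - x) < s \<longrightarrow> y \<in> W"
      by blast
    then show ?case
      by (intro exI[of _ "min r s"]) auto
  next
    case (UN K)
    then show ?case
      by (meson UnionE UnionI)
  next
    case (Basis V)
    then obtain f U where f: "f \<in> P" and V: "V = f -` U" "open U"
      by blast
    then obtain e where e: "e > 0" "ball (f x) e \<subseteq> U"
      using Basis.prems open_contains_ball by blast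
    define c where "c = \<bar>dual_norm nrm f\<bar> + 1"
    have "c > 0"
      by (simp add: c_def)
    show ?case
    proof (intro exI conjI allI impI)
      show "e / c > 0"
        using e \<open>c > 0\<close> by simp
      fix y assume y: "nrm (y - x) < e / c"
      have "f y = f ((y - x) + x)"
        by simp
      then have "f y - f x = f (y - x)"
        unfolding predual_linear(1)[OF f] by simp
      then have "cmod (f y - f x) \<le> dual_norm nrm f * nrm (y - x)"
        using predual_bound[OF f] by simp
      also have "\<dots> \<le> c * nrm (y - x)"
        by (intro mult_right_mono) (auto simp: c_def)
      also have "\<dots> < e"
        using y \<open>c > 0\<close> by (simp add: pos_less_divide_eq mult.commute)
      finally show "y \<in> V"
        using e V by (auto simp: dist_norm norm_minus_commute)
    qed
  qed auto
  have D0: "D 0 = 0"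
    using scale[of 0 0] by simp
  have top: "topspace (weak_topology P) = UNIV"
    using predual_zero by (intro topspace_weak_topology) blast
  have "openin (weak_topology P) {x \<in> topspace (weak_topology P). D x \<in> ball 0 1}"
    using cont by (rule openin_continuous_map_preimage) simp
  then have "openin (weak_topology P) {x. D x \<in> ball 0 1}"
    by (simp add: top)
  from nbhd[OF this, of 0] obtain r where r: "r > 0" "\<And>y. nrm y < r \<Longrightarrow> cmod (D y) < 1"
    by (auto simp: D0)
  have "cmod (D x) \<le> 2 / r * nrm x" for x
  proof (cases "x = 0")
    case False
    then have x: "nrm x > 0"
      using nrm_nonneg[of x] nrm_eq_0[of x] by linarith
    define t where "t = r / (2 * nrm x)"
    have t: "t > 0"
      using x r by (simp add: t_def)
    have "nrm (of_r t * x) < r"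
      using x r t by (simp add: nrm_of_r_mult) (simp add: t_def)
    then have "cmod (D (of_r t * x)) < 1"
      by (rule r)
    then have "t * cmod (D x) < 1"
      using t by (simp add: of_r_def scale norm_mult)
    then show ?thesis
      using x r by (simp add: t_def field_simps)
  qed (simp add: D0)
  then show ?thesis
    by blast
qed

end

section \<open>The inner product\<close>

lemma cinner_zero_left [simp]: "cinner 0 (y::'h::chilbert_space) = 0"
  using cinner_add_left[of "0::'h" 0 y] by simp

lemma cinner_minus_left: "cinner (- x) y = - cinner x (y::'h::chilbert_space)"
  using cinner_add_left[of x "- x" y] by (simp add: eq_neg_iff_add_eq_0 add.commute)

lemma cinner_diff_left: "cinner (x - y) z = cinner x z - cinner y (z::'h::chilbert_space)"
  using cinner_add_left[of x "- y" z] by (simp add: cinner_minus_left)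

lemma cinner_add_right: "cinner x (y + z) = cinner x y + cinner x (z::'h::chilbert_space)"
  by (metis cinner_add_left cinner_commute complex_cnj_add)

lemma cinner_diff_right: "cinner x (y - z) = cinner x y - cinner x (z::'h::chilbert_space)"
  by (metis cinner_diff_left cinner_commute complex_cnj_diff)

lemma cinner_scaleC_right: "cinner x (a *\<^sub>C y) = cnj a * cinner x (y::'h::chilbert_space)"
  by (metis cinner_scaleC_left cinner_commute complex_cnj_mult)

text \<open>Cauchy-Schwarz, by expanding the squared norm of a x - b y with a = (norm y)^2 and b =
  \<open>cinner x y\<close>. This vector is a times the component of x orthogonal to y, so no
  division occurs.\<close>

lemma cmod_cinner_le: "cmod (cinner x y) \<le> norm x * norm (y::'h::chilbert_space)"
proof (cases "y = 0")
  case True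
  then show ?thesis
    using cinner_commute[of x 0] by simp
next
  case False
  define a b where "a = complex_of_real ((norm y)\<^sup>2)" and "b = cinner x y"
  have "cinner (a *\<^sub>C x - b *\<^sub>C y) (a *\<^sub>C x - b *\<^sub>C y)
      = a * cnj a * cinner x x - a * cnj b * b - b * cnj a * cnj b + b * cnj b * a"
  proof -
    have "cinner y x = cnj b" "cinner y y = a"
      using cinner_commute[of y x] by (simp_all add: a_def b_def cinner_same)
    then show ?thesis
      unfolding cinner_diff_left cinner_diff_right cinner_scaleC_left cinner_scaleC_right b_def[symmetric]
      by (simp add: algebra_simps)
  qed
  also have "\<dots> = of_real ((norm y)\<^sup>2 * ((norm x)\<^sup>2 * (norm y)\<^sup>2 - (cmod b)\<^sup>2))"
    unfolding of_real_mult of_real_diff complex_norm_square by (simp add: a_def cinner_same algebra_simps)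
  finally have "(norm y)\<^sup>2 * ((norm x)\<^sup>2 * (norm y)\<^sup>2 - (cmod b)\<^sup>2) = (norm (a *\<^sub>C x - b *\<^sub>C y))\<^sup>2"
    unfolding cinner_same of_real_eq_iff by simp
  then have "0 \<le> (norm y)\<^sup>2 * ((norm x)\<^sup>2 * (norm y)\<^sup>2 - (cmod b)\<^sup>2)"
    by simp
  moreover have "0 < (norm y)\<^sup>2"
    using False by simp
  ultimately have "(cmod b)\<^sup>2 \<le> (norm x * norm y)\<^sup>2"
    by (simp add: zero_le_mult_iff power_mult_distrib)
  then show ?thesis
    unfolding b_def by (rule power2_le_imp_le) simp
qed

lemma cinner_in_dual: "(\<lambda>x. cinner x v) \<in> dual norm"
  unfolding dual_def bounded_clinear_def clinear_iff mem_Collect_eq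
proof (intro conjI exI[of _ "norm v"] allI)
  show "norm (cinner x v) \<le> norm v * norm x" for x
    using cmod_cinner_le[of x v] by (simp add: mult.commute)
qed (simp_all add: cinner_add_left cinner_scaleC_left scaleC_complex_def)


section \<open>Matrices\<close>

lemmas mat2_ops = zero_mat2_def one_mat2_def plus_mat2_def minus_mat2_def uminus_mat2_def
  times_mat2_def scaleC_mat2_def adj_mat2_def

lemma mat2_eq_iff: "x = y \<longleftrightarrow> (\<forall>i j. entries x $ i $ j = entries y $ i $ j)"
  by (metis mat2.expand vec_eq_iff)

lemma entries_simps [simp]:
  "entries 0 $ i $ j = 0"
  "entries (x + y) $ i $ j = entries x $ i $ j + entries y $ i $ j"
  "entries (c *\<^sub>C x) $ i $ j = c *\<^sub>C (entries x $ i $ j)"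
  "entries (adj x) $ i $ j = adj (entries x $ j $ i)"
  "entries (matrix_unit k l a) $ i $ j = (if i = k \<and> j = l then a else 0)"
  by (simp_all add: mat2_ops matrix_unit_def)

lemma entries_mult:
  "entries (x * y) $ i $ j = entries x $ i $ 1 * entries y $ 1 $ j + entries x $ i $ 2 * entries y $ 2 $ j"
  by (simp add: times_mat2_def matrix_matrix_mult_def sum_2)

lemma matrix_unit_mult: "matrix_unit i j a * matrix_unit j k b = matrix_unit i k (a * b)"
  using exhaust_2[of j] by (auto simp: mat2_eq_iff entries_mult)

lemma matrix_unit_corner:
  "matrix_unit 1 i 1 * x * matrix_unit j 1 1 = matrix_unit 1 1 (entries x $ i $ j)"
  using exhaust_2[of i] exhaust_2[of j] by (auto simp: mat2_eq_iff entries_mult)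

lemma adj_matrix_unit: "adj (matrix_unit i j a) = matrix_unit j i (adj a)"
  by (auto simp: mat2_eq_iff)

text \<open>The embedding of the entries as the upper left corner is an injective star-homomorphism,
  and a C*-norm pulls back along it.\<close>

lemma cstar_norm_corner:
  fixes nN :: "'m::{comm_ring_1, complex_star_algebra_1} mat2 \<Rightarrow> real"
  assumes "cstar_norm nN"
  shows "comm_cstar_norm (\<lambda>a. nN (matrix_unit 1 1 a))"
proof -
  interpret cstar_norm nN by fact
  show ?thesis
  proof
    fix x y :: 'm and c
    have "matrix_unit 1 1 x = 0 \<longleftrightarrow> x = 0"
      by (auto simp: mat2_eq_iff)
    then show "nN (matrix_unit 1 1 x) = 0 \<longleftrightarrow> x = 0"
      by (simp add: nrm_eq_0)
    have "matrix_unit 1 1 (x + y) = matrix_unit 1 1 x + matrix_unit 1 1 y"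
      by (auto simp: mat2_eq_iff)
    then show "nN (matrix_unit 1 1 (x + y)) \<le> nN (matrix_unit 1 1 x) + nN (matrix_unit 1 1 y)"
      by (simp add: nrm_triangle)
    have "matrix_unit 1 1 (c *\<^sub>C x) = c *\<^sub>C matrix_unit 1 1 x"
      by (auto simp: mat2_eq_iff)
    then show "nN (matrix_unit 1 1 (c *\<^sub>C x)) = cmod c * nN (matrix_unit 1 1 x)"
      by (simp add: nrm_scaleC)
    show "nN (matrix_unit 1 1 (x * y)) \<le> nN (matrix_unit 1 1 x) * nN (matrix_unit 1 1 y)"
      using nrm_mult[of "matrix_unit 1 1 x" "matrix_unit 1 1 y"] by (simp add: matrix_unit_mult)
    show "nN (matrix_unit 1 1 (adj x * x)) = (nN (matrix_unit 1 1 x))\<^sup>2"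
      using nrm_cstar[of "matrix_unit 1 1 x"] by (simp add: matrix_unit_mult adj_matrix_unit)
  qed
qed

text \<open>The diagonal unit is a projection, so its norm equals its own square; an arbitrary unit
  e satisfies adj e * e = a diagonal unit.\<close>

lemma nrm_matrix_unit_one_le:
  fixes nN :: "'m::{comm_ring_1, complex_star_algebra_1} mat2 \<Rightarrow> real"
  assumes "cstar_norm nN"
  shows "nN (matrix_unit i j 1) \<le> 1"
proof -
  interpret cstar_norm nN by fact
  have "nN (matrix_unit j j 1) = (nN (matrix_unit j j 1))\<^sup>2"
    using nrm_cstar[of "matrix_unit j j 1"] by (simp add: matrix_unit_mult adj_matrix_unit)
  then have "nN (matrix_unit j j 1) \<le> 1"
    by (auto simp: power2_eq_square)
  moreover have "nN (matrix_unit j j 1) = (nN (matrix_unit i j 1))\<^sup>2"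
    using nrm_cstar[of "matrix_unit i j 1"] by (simp add: matrix_unit_mult adj_matrix_unit)
  ultimately have "(nN (matrix_unit i j 1))\<^sup>2 \<le> 1\<^sup>2"
    by simp
  then show ?thesis
    by (rule power2_le_imp_le) simp
qed

text \<open>Matrix units move the entry to the upper left corner without increasing
  \<open>nN\<close>; there \<open>nN\<close> is a C*-norm on the commutative algebra and so
  dominates \<open>nrm\<close>.\<close>

lemma (in comm_wstar_algebra) nrm_entry_le:
  assumes "cstar_norm nN"
  shows "nrm (entries x $ i $ j) \<le> nN x"
proof -
  interpret N: cstar_norm nN by fact
  let ?E = "matrix_unit 1 i 1" and ?E' = "matrix_unit j 1 1"
  have "nrm (entries x $ i $ j) \<le> nN (?E * x * ?E')"
    unfolding matrix_unit_corner by (rule nrm_le_cstar_norm[OF cstar_norm_corner[OF assms]])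
  also have "\<dots> \<le> nN (?E * x) * nN ?E'"
    by (rule N.nrm_mult)
  also have "\<dots> \<le> nN (?E * x) * 1"
    using nrm_matrix_unit_one_le[OF assms] by (intro mult_left_mono) auto
  also have "nN (?E * x) * 1 \<le> nN ?E * nN x"
    using N.nrm_mult[of ?E x] by simp
  also have "\<dots> \<le> 1 * nN x"
    using nrm_matrix_unit_one_le[OF assms] by (intro mult_right_mono) auto
  finally show ?thesis by simp
qed

section \<open>Linearity and w*-continuity of entrywise maps\<close>

lemma clinear_entrywise_map:
  assumes "\<And>i j. clinear (F i j)"
  shows "clinear (entrywise_map F :: 'm::complex_star_algebra_1 mat2 \<Rightarrow> 'h::complex_vector)"
  using assms by (simp add: clinear_iff entrywise_map_def sum_2 scaleC_add_right algebra_simps)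

lemma continuous_map_entry:
  assumes P: "(\<lambda>x. 0) \<in> P" "\<And>f. f \<in> P \<Longrightarrow> f 0 = 0"
  shows "continuous_map (weak_topology (mat2_predual P)) (weak_topology P) (\<lambda>x. entries x $ i $ j)"
proof (rule continuous_map_into_weak_topology)
  fix f assume f: "f \<in> P"
  \<comment> \<open>A matrix functional with f in position (i, j) and the zero functional elsewhere;
    it belongs to the predual of the matrix algebra.\<close>
  define G where "G k l = (if k = i \<and> l = j then f else (\<lambda>x. 0))" for k l
  have "(\<lambda>x. f (entries x $ i $ j)) = entrywise_map G"
    using exhaust_2[of i] exhaust_2[of j] by (auto simp: entrywise_map_def sum_2 G_def)
  moreover have "entrywise_map G \<in> mat2_predual P"
    unfolding mat2_predual_def using f P by (auto simp: G_def)
  ultimately show "continuous_map (weak_topology (mat2_predual P)) euclidean (\<lambda>x. f (entries x $ i $ j))"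
    by (simp add: continuous_map_weak_topology_functional)
qed (use P in blast)

lemma continuous_map_entrywise_map:
  fixes F :: "2 \<Rightarrow> 2 \<Rightarrow> 'm::complex_star_algebra_1 \<Rightarrow> 'h::chilbert_space"
  assumes P: "(\<lambda>x. 0) \<in> P" "\<And>f. f \<in> P \<Longrightarrow> f 0 = 0"
    and F: "\<And>i j. continuous_map (weak_topology P) (weak_topology (dual norm)) (F i j)"
  shows "continuous_map (weak_topology (mat2_predual P)) (weak_topology (dual norm)) (entrywise_map F)"
proof (rule continuous_map_into_weak_topology)
  fix g :: "'h \<Rightarrow> complex" assume g: "g \<in> dual norm"
  have add: "g (x + y) = g x + g y" for x y
    using g by (simp add: dual_def bounded_clinear_def clinear_iff)
  have cont: "continuous_map (weak_topology (mat2_predual P)) euclidean (\<lambda>x. g (F i j (entries x $ i $ j)))" for i j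
  proof -
    have "continuous_map (weak_topology (mat2_predual P)) (weak_topology P) (\<lambda>x. entries x $ i $ j)"
      using P by (rule continuous_map_entry)
    from continuous_map_compose[OF continuous_map_compose[OF this F[of i j]]
        continuous_map_weak_topology_functional[OF g]]
    show ?thesis
      by (simp add: o_def)
  qed
  show "continuous_map (weak_topology (mat2_predual P)) euclidean (\<lambda>x. g (entrywise_map F x))"
    unfolding entrywise_map_def sum_2 add by (intro continuous_map_add cont)
qed (use cinner_in_dual in blast)


section \<open>Orthogonality of the assembled field\<close>

text \<open>Boundedness enters through \<open>bdd\<close> in weak form, which bounded fields and
  w*-continuous fields both provide; so both versions of the theorem rest on this lemma.\<close>

lemma (in comm_wstar_algebra) orthogonal_entrywise_map:
  fixes F :: "2 \<Rightarrow> 2 \<Rightarrow> 'a \<Rightarrow> 'h::chilbert_space"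
  assumes lin: "\<And>i j. clinear (F i j)"
    and bdd: "\<And>i j v. \<exists>C. \<forall>a. cmod (cinner (F i j a) v) \<le> C * nrm a"
    and i: "\<And>a b. cinner (F 1 1 a) (F 2 2 b) = 0" "\<And>a b. cinner (F 1 2 a) (F 2 1 b) = 0"
    and ii: "\<And>a. (norm (F 1 2 a))\<^sup>2 + (norm (F 2 1 a))\<^sup>2 = (norm (F 1 1 a))\<^sup>2 + (norm (F 2 2 a))\<^sup>2"
    and iii: "\<And>a b i j k l. cinner (F i j a) (F k l b) = cinner (F i j (adj b * a)) (F k l 1)"
    and iv: "\<And>p. p \<in> projections \<Longrightarrow> cinner (F 1 2 p) (F 1 1 1) = cinner (F 2 2 1) (F 2 1 p)"
      "\<And>p. p \<in> projections \<Longrightarrow> cinner (F 2 1 p) (F 1 1 1) = cinner (F 2 2 1) (F 1 2 p)"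
  shows "orthogonal_on_projections (entrywise_map F)"
proof -
  define \<phi> where "\<phi> i j k l a = cinner (F i j a) (F k l 1)" for i j k l a
  have \<phi>: "cinner (F i j a) (F k l b) = \<phi> i j k l (adj b * a)" for i j k l a b
    unfolding \<phi>_def by (rule iii)
  have \<phi>_add: "\<phi> i j k l (a + b) = \<phi> i j k l a + \<phi> i j k l b" for i j k l a b
    using lin by (simp add: \<phi>_def clinear_iff cinner_add_left)
  have \<phi>_scale: "\<phi> i j k l (of_scalar c * a) = c * \<phi> i j k l a" for i j k l a c
    using lin[of i j] unfolding \<phi>_def scaleC_conv_mult[symmetric] clinear_iff
    by (simp add: cinner_scaleC_left)
  have \<phi>_0: "\<phi> i j k l 0 = 0" for i j k l
    using \<phi>_scale[of i j k l 0 0] by simp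
  have \<phi>_minus: "\<phi> i j k l (- a) = - \<phi> i j k l a" for i j k l a
    using \<phi>_add[of i j k l a "- a"] \<phi>_0 by (simp add: eq_neg_iff_add_eq_0 add.commute)
  have \<phi>_cnj: "\<phi> k l i j a = cnj (\<phi> i j k l (adj a))" for i j k l a
    using \<phi>[of i j 1 k l a] cinner_commute[of "F k l a" "F i j 1"] by (simp add: \<phi>_def)
  have zero: "\<phi> 1 1 2 2 a = 0" "\<phi> 1 2 2 1 a = 0" "\<phi> 2 2 1 1 a = 0" "\<phi> 2 1 1 2 a = 0" for a
    using \<phi>_cnj[of 2 2 1 1 a] \<phi>_cnj[of 2 1 1 2 a] by (simp_all add: \<phi>_def i)
  \<comment> \<open>The difference of the two functionals is bounded and vanishes on projections,
    hence everywhere by \<open>bounded_functional_eq_0\<close>.\<close>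
  have eq_functional: "\<phi> i j k l a = \<phi> i' j' k' l' a"
    if proj: "\<And>p. p \<in> projections \<Longrightarrow> \<phi> i j k l p = \<phi> i' j' k' l' p" for i j k l i' j' k' l' a
  proof -
    obtain C C' where C: "\<And>a. cmod (\<phi> i j k l a) \<le> C * nrm a" "\<And>a. cmod (\<phi> i' j' k' l' a) \<le> C' * nrm a"
      using bdd[of i j "F k l 1"] bdd[of i' j' "F k' l' 1"] unfolding \<phi>_def by blast
    have "\<phi> i j k l a - \<phi> i' j' k' l' a = 0"
    proof (rule bounded_functional_eq_0[where D = "\<lambda>a. \<phi> i j k l a - \<phi> i' j' k' l' a" and C = "C + C'"])
      show "cmod (\<phi> i j k l x - \<phi> i' j' k' l' x) \<le> (C + C') * nrm x" for x
        using C(1)[of x] C(2)[of x] norm_triangle_ineq4[of "\<phi> i j k l x" "\<phi> i' j' k' l' x"]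
        unfolding distrib_right by linarith
    qed (simp_all add: \<phi>_add \<phi>_scale proj right_diff_distrib)
    then show ?thesis by simp
  qed
  have padj: "adj p = p" if "p \<in> projections" for p :: 'a
    using that unfolding projections_def by blast
  \<comment> \<open>(iv) in terms of \<open>\<phi>\<close>: since adj p = p, the inner product of F
    i j 1 with F k l p is the functional at p itself.\<close>
  have cross: "\<phi> 1 2 1 1 a = \<phi> 2 2 2 1 a" "\<phi> 2 1 1 1 a = \<phi> 2 2 1 2 a" for a
  proof -
    show "\<phi> 1 2 1 1 a = \<phi> 2 2 2 1 a"
    proof (rule eq_functional)
      fix p :: 'a assume p: "p \<in> projections"
      show "\<phi> 1 2 1 1 p = \<phi> 2 2 2 1 p"
        using iv(1)[OF p] \<phi>[of 2 2 1 2 1 p] padj[OF p] by (simp add: \<phi>_def)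
    qed
    show "\<phi> 2 1 1 1 a = \<phi> 2 2 1 2 a"
    proof (rule eq_functional)
      fix p :: 'a assume p: "p \<in> projections"
      show "\<phi> 2 1 1 1 p = \<phi> 2 2 1 2 p"
        using iv(2)[OF p] \<phi>[of 2 2 1 1 2 p] padj[OF p] by (simp add: \<phi>_def)
    qed
  qed
  have cross': "\<phi> 1 1 1 2 a = \<phi> 2 1 2 2 a" "\<phi> 1 1 2 1 a = \<phi> 1 2 2 2 a" for a
    unfolding \<phi>_cnj[of 1 1 1 2] \<phi>_cnj[of 2 1 2 2] \<phi>_cnj[of 1 1 2 1] \<phi>_cnj[of 1 2 2 2] cross
    by simp_all
  \<comment> \<open>The defect in (ii) as a linear functional, which vanishes at every adj a * a.
    Comparing (h + 1)^2 with h^2 and 1 makes it vanish at selfadjoint h, and hence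
    everywhere.\<close>
  define E where "E a = \<phi> 1 2 1 2 a + \<phi> 2 1 2 1 a - \<phi> 1 1 1 1 a - \<phi> 2 2 2 2 a" for a
  have E_add: "E (a + b) = E a + E b" for a b
    by (simp add: E_def \<phi>_add)
  have E_scale: "E (of_scalar c * a) = c * E a" for c a
    by (simp add: E_def \<phi>_scale right_diff_distrib distrib_left)
  have E_square: "E (adj a * a) = 0" for a
  proof -
    have "E (adj a * a) = of_real ((norm (F 1 2 a))\<^sup>2 + (norm (F 2 1 a))\<^sup>2
        - ((norm (F 1 1 a))\<^sup>2 + (norm (F 2 2 a))\<^sup>2))"
      unfolding E_def \<phi>[symmetric] cinner_same by simp
    then show ?thesis
      unfolding ii by simp
  qed
  have E_selfadjoint: "E h = 0" if "selfadjoint h" for h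
  proof -
    have eq: "(h + 1) * (h + 1) = h * h + (h + h) + 1"
      by (simp add: algebra_simps)
    have "E ((h + 1) * (h + 1)) = E (h * h) + (E h + E h) + E 1"
      unfolding eq E_add ..
    moreover have "E (h * h) = 0" "E ((h + 1) * (h + 1)) = 0" "E 1 = 0"
      using E_square[of h] E_square[of "h + 1"] E_square[of 1] that
      by (simp_all add: selfadjoint_def adj_add)
    ultimately show ?thesis by simp
  qed
  have E: "E a = 0" for a
  proof -
    obtain b c where "selfadjoint b" "selfadjoint c" "a = b + imag_unit * c"
      using cartesian_decomposition .
    then show ?thesis
      by (simp add: E_add E_scale E_selfadjoint)
  qed
  show ?thesis
    unfolding orthogonal_on_projections_def
  proof (intro ballI impI)
    fix p q :: "'a mat2"
    assume p: "p \<in> projections" and q: "q \<in> projections" and pq: "p * q = 0"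
    have p_adj: "adj p = p" and q_adj: "adj q = q"
      using p q unfolding projections_def by blast+
    have "q * p = adj (p * q)"
      by (simp only: adj_mult p_adj q_adj)
    then have qp: "q * p = 0"
      by (simp add: pq)
    define p11 p12 p21 p22 where "p11 = entries p $ 1 $ 1" and "p12 = entries p $ 1 $ 2"
      and "p21 = entries p $ 2 $ 1" and "p22 = entries p $ 2 $ 2"
    define q11 q12 q21 q22 where "q11 = entries q $ 1 $ 1" and "q12 = entries q $ 1 $ 2"
      and "q21 = entries q $ 2 $ 1" and "q22 = entries q $ 2 $ 2"
    note p_defs = p11_def p12_def p21_def p22_def and q_defs = q11_def q12_def q21_def q22_def
    have q_adj_entry: "adj (entries q $ j $ i) = entries q $ i $ j" for i j
      using entries_simps(4)[of q i j] by (simp only: q_adj)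
    have adj: "adj q11 = q11" "adj q12 = q21" "adj q21 = q12" "adj q22 = q22"
      unfolding q_defs by (simp_all only: q_adj_entry)
    have pq_entry: "entries p $ i $ 1 * entries q $ 1 $ j + entries p $ i $ 2 * entries q $ 2 $ j = 0" for i j
      using entries_mult[of p q i j] by (simp add: pq)
    have qp_entry: "entries q $ i $ 1 * entries p $ 1 $ j + entries q $ i $ 2 * entries p $ 2 $ j = 0" for i j
      using entries_mult[of q p i j] by (simp add: qp)
    \<comment> \<open>The entries of p q = 0 and q p = 0, oriented so that rewriting turns the four
      diagonal products into q11 * p11 up to sign and makes each pair of mixed products
      opposite.\<close>
    have eqs: "q21 * p12 = - (q11 * p11)" "q12 * p21 = - (q11 * p11)" "q22 * p22 = - (q21 * p12)"
      "q11 * p12 = - (q12 * p22)" "q11 * p21 = - (q21 * p22)"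
      "q21 * p11 = - (q22 * p21)" "q12 * p11 = - (q22 * p12)"
      using pq_entry[of 1 1] qp_entry[of 1 1] qp_entry[of 2 2] qp_entry[of 1 2] pq_entry[of 2 1]
        qp_entry[of 2 1] pq_entry[of 1 2]
      unfolding p_defs[symmetric] q_defs[symmetric]
      by (simp_all add: eq_neg_iff_add_eq_0 ac_simps)
    \<comment> \<open>Of the sixteen terms four vanish by (i). The eight mixed ones are paired so
      that \<open>cross\<close> and \<open>cross'\<close> identify the two functionals in each
      pair.\<close>
    have "cinner (entrywise_map F p) (entrywise_map F q)
      = \<phi> 1 1 1 1 (q11 * p11) + \<phi> 2 2 2 2 (q22 * p22) + \<phi> 1 2 1 2 (q21 * p12) + \<phi> 2 1 2 1 (q12 * p21)
      + (\<phi> 1 2 1 1 (q11 * p12) + \<phi> 2 2 2 1 (q12 * p22)) + (\<phi> 2 1 1 1 (q11 * p21) + \<phi> 2 2 1 2 (q21 * p22))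
      + (\<phi> 1 1 1 2 (q21 * p11) + \<phi> 2 1 2 2 (q22 * p21)) + (\<phi> 1 1 2 1 (q12 * p11) + \<phi> 1 2 2 2 (q22 * p12))"
      unfolding entrywise_map_def sum_2 p_defs[symmetric] q_defs[symmetric]
        cinner_add_left cinner_add_right \<phi> adj zero
      by simp
    also have "\<dots> = - E (q11 * p11)"
      unfolding eqs cross cross' \<phi>_minus minus_minus E_def by simp
    finally show "cinner (entrywise_map F p) (entrywise_map F q) = 0"
      by (simp add: E)
  qed
qed

section \<open>The bounded and the w*-continuous version\<close>

theorem theorem3:
  fixes nM :: "'m::{comm_ring_1, complex_star_algebra_1} \<Rightarrow> real"
    and PM :: "('m \<Rightarrow> complex) set"
    and nN :: "'m mat2 \<Rightarrow> real"
    and F :: "2 \<Rightarrow> 2 \<Rightarrow> 'm \<Rightarrow> 'h::chilbert_space"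
  assumes M: "wstar_algebra nM PM"
    and N: "wstar_algebra nN (mat2_predual PM)"
    and i: "\<And>a b. cinner (F 1 1 a) (F 2 2 b) = 0" "\<And>a b. cinner (F 1 2 a) (F 2 1 b) = 0"
    and ii: "\<And>a. (norm (F 1 2 a))\<^sup>2 + (norm (F 2 1 a))\<^sup>2 = (norm (F 1 1 a))\<^sup>2 + (norm (F 2 2 a))\<^sup>2"
    and iii: "\<And>a b i j k l. cinner (F i j a) (F k l b) = cinner (F i j (adj b * a)) (F k l 1)"
    and iv: "\<And>p. p \<in> projections \<Longrightarrow> cinner (F 1 2 p) (F 1 1 1) = cinner (F 2 2 1) (F 2 1 p)"
      "\<And>p. p \<in> projections \<Longrightarrow> cinner (F 2 1 p) (F 1 1 1) = cinner (F 2 2 1) (F 1 2 p)"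
  shows "((\<forall>i j. ovf nM (F i j)) \<longrightarrow> ovf nN (entrywise_map F)) \<and>
    ((\<forall>i j. wstar_continuous_ovf PM (F i j)) \<longrightarrow>
       wstar_continuous_ovf (mat2_predual PM) (entrywise_map F))"
proof (intro conjI impI)
  interpret comm_wstar_algebra nM PM
    using M by (rule comm_wstar_algebra.intro)
  interpret N: wstar_algebra nN "mat2_predual PM" by fact
  note orthogonal = orthogonal_entrywise_map[OF _ _ i ii iii iv]
  {
    assume F: "\<forall>i j. ovf nM (F i j)"
    then have lin: "clinear (F i j)" for i j
      by (simp add: ovf_def bounded_clinear_def)
    have "\<exists>C. \<forall>a. norm (F i j a) \<le> C * nM a" for i j
      using F by (simp add: ovf_def bounded_clinear_def)
    then obtain C where C: "\<And>i j a. norm (F i j a) \<le> C i j * nM a"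
      by metis
    have "\<exists>C. \<forall>a. cmod (cinner (F i j a) v) \<le> C * nM a" for i j v
    proof (intro exI allI)
      fix a
      have "cmod (cinner (F i j a) v) \<le> norm (F i j a) * norm v"
        by (rule cmod_cinner_le)
      also have "\<dots> \<le> (C i j * nM a) * norm v"
        using C by (intro mult_right_mono) auto
      finally show "cmod (cinner (F i j a) v) \<le> (C i j * norm v) * nM a"
        by (simp only: ac_simps)
    qed
    then have "orthogonal_on_projections (entrywise_map F)"
      by (intro orthogonal lin)
    moreover have "norm (entrywise_map F x) \<le> (\<Sum>i\<in>UNIV. \<Sum>j\<in>UNIV. \<bar>C i j\<bar>) * nN x" for x
    proof -
      \<comment> \<open>The constants may be negative; absolute values allow the norm of the entry
        to be replaced by the larger \<open>nN x\<close>.\<close>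
      have "norm (F i j (entries x $ i $ j)) \<le> \<bar>C i j\<bar> * nN x" for i j
      proof -
        have "norm (F i j (entries x $ i $ j)) \<le> C i j * nM (entries x $ i $ j)"
          by (rule C)
        also have "\<dots> \<le> \<bar>C i j\<bar> * nN x"
          using nrm_entry_le[OF N.cstar_norm_axioms] by (intro mult_mono) auto
        finally show ?thesis .
      qed
      then have "norm (entrywise_map F x) \<le> (\<Sum>i\<in>UNIV. \<Sum>j\<in>UNIV. \<bar>C i j\<bar> * nN x)"
        unfolding entrywise_map_def by (intro sum_norm_le)
      then show ?thesis
        by (simp only: sum_distrib_right)
    qed
    ultimately show "ovf nN (entrywise_map F)"
      unfolding ovf_def bounded_clinear_def using clinear_entrywise_map[of F, OF lin] by blast
  }
  {
    assume F: "\<forall>i j. wstar_continuous_ovf PM (F i j)"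
    then have lin: "clinear (F i j)"
      and cont: "continuous_map (weak_topology PM) (weak_topology (dual norm)) (F i j)" for i j
      by (simp_all add: wstar_continuous_ovf_def)
    have "\<exists>C. \<forall>a. cmod (cinner (F i j a) v) \<le> C * nM a" for i j v
    proof -
      \<comment> \<open>Pairing with v is one of the functionals that define the weak topology, so
        the composite is a scalar w*-continuous functional and hence bounded.\<close>
      have "continuous_map (weak_topology PM) euclidean ((\<lambda>x. cinner x v) \<circ> F i j)"
        using cont continuous_map_weak_topology_functional[OF cinner_in_dual]
        by (rule continuous_map_compose)
      then have "continuous_map (weak_topology PM) euclidean (\<lambda>a. cinner (F i j a) v)"
        by (simp add: o_def)
      then show ?thesis
      proof (rule weakly_continuous_functional_bounded[rotated 2])
        show "cinner (F i j (a + b)) v = cinner (F i j a) v + cinner (F i j b) v" for a b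
          using lin[of i j] by (simp add: clinear_iff cinner_add_left)
        show "cinner (F i j (of_scalar c * a)) v = c * cinner (F i j a) v" for c a
          using lin[of i j] unfolding scaleC_conv_mult[symmetric] clinear_iff by (simp add: cinner_scaleC_left)
      qed
    qed
    then have "orthogonal_on_projections (entrywise_map F)"
      by (intro orthogonal lin)
    moreover have "continuous_map (weak_topology (mat2_predual PM)) (weak_topology (dual norm)) (entrywise_map F)"
      using predual_zero predual_zero_eq cont by (rule continuous_map_entrywise_map)
    ultimately show "wstar_continuous_ovf (mat2_predual PM) (entrywise_map F)"
      unfolding wstar_continuous_ovf_def using clinear_entrywise_map[of F, OF lin] by blast
  }
qed

end
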